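(* Let $(n_1,n_2,a_1,a_2,a_3)\in \mathbb{N}^5$ be a solution to the Diophantine equation $$F_{n_1} + F_{n_2} = 2^{a_1} + 2^{a_2} + 2^{a_3}$$ such that $n_1 \geq n_2 \geq 0$ and $a_1 \geq a_2 \geq a_3 \geq 0$. Then $n_1 \leq 18$ and $a_1 \leq 11$. In particular, this equation has exactly $78$ solutions (with $n_1 \geq n_2 \geq 0$ and $a_1 \geq a_2 \geq a_3 \geq 0$).
   Context: $F_k$ denotes the $k$-th Fibonacci number: $F_0=0$, $F_1=1$, $F_{k+2}=F_{k+1}+F_k$ for $k\geq 0$. Here $\mathbb{N}$ includes $0$. *)

theory Defs
  imports "HOL-Number_Theory.Fib"
begin

definition fib_pow2_solutions :: "(nat \<times> nat \<times> nat \<times> nat \<times> nat) set" where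
  "fib_pow2_solutions = {(n1, n2, a1, a2, a3). n2 \<le> n1 \<and> a3 \<le> a2 \<and> a2 \<le> a1 \<and>
      fib n1 + fib n2 = 2 ^ a1 + 2 ^ a2 + 2 ^ a3}"

end

theory Submission
  imports Defs "HOL-Number_Theory.Cong"
begin

text \<open>
  Suppose \<open>a1 \<ge> 13\<close>. The five terms of \<open>F n1 + F n2 - 2 ^ a1 - 2 ^ a2 - 2 ^ a3 = 0\<close> are followed
  through a chain of moduli \<open>m\<close>, each dividing both a number \<open>F N\<close> with \<open>F (N + 1) \<equiv> 1\<close> and
  \<open>2 ^ 13 * (2 ^ T - 1)\<close> for small smooth \<open>N\<close> and \<open>T\<close>. Modulo \<open>m\<close> the terms depend only on the residues
  of \<open>n1, n2\<close> modulo \<open>N\<close> and of the exponents modulo \<open>T\<close>, except that an exponent below 13 is kept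
  exactly. Refining the residue classes from one modulus to the next, and discarding the combinations
  whose sum is not \<open>0\<close>, leaves few classes at each stage; these are mostly the solutions in
  integers, with \<open>F (-n) = \<plusminus> F n\<close>, the largest of which is \<open>F 19 + F (-8) = 2 ^ 12 + 2 ^ 6\<close>.
  They are eliminated at the end because \<open>2 ^ a1 \<equiv> 0\<close> modulo \<open>2 ^ 13\<close>. Hence \<open>a1 \<le> 12\<close>, and a finite
  enumeration remains.
\<close>

section \<open>Residues as binary numerals\<close>

text \<open>The size of a negative difference is not recorded: it only signals that nothing is to be
  reduced.\<close>

datatype diff = Neg | Zero | Pos num

fun diff_spec :: "diff \<Rightarrow> int \<Rightarrow> bool" where
  "diff_spec Neg k \<longleftrightarrow> k < 0"
| "diff_spec Zero k \<longleftrightarrow> k = 0"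
| "diff_spec (Pos z) k \<longleftrightarrow> k = numeral z"

text \<open>\<open>shift_diff x y d\<close> turns the difference \<open>d\<close> of the leading bits into \<open>2 * d + x - y\<close>.\<close>

fun shift_diff :: "bool \<Rightarrow> bool \<Rightarrow> diff \<Rightarrow> diff" where
  "shift_diff x y Neg = Neg"
| "shift_diff True False Zero = Pos num.One"
| "shift_diff False True Zero = Neg"
| "shift_diff True True Zero = Zero"
| "shift_diff False False Zero = Zero"
| "shift_diff True False (Pos z) = Pos (num.Bit1 z)"
| "shift_diff False True (Pos z) = Pos (Num.BitM z)"
| "shift_diff True True (Pos z) = Pos (num.Bit0 z)"
| "shift_diff False False (Pos z) = Pos (num.Bit0 z)"

text \<open>Comparison and subtraction share one recursion over the binary digits, so reduction
  needs no separate test.\<close>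

fun num_diff :: "num \<Rightarrow> num \<Rightarrow> diff" where
  "num_diff num.One num.One = Zero"
| "num_diff num.One (num.Bit0 y) = Neg"
| "num_diff num.One (num.Bit1 y) = Neg"
| "num_diff (num.Bit0 x) num.One = Pos (Num.BitM x)"
| "num_diff (num.Bit1 x) num.One = Pos (num.Bit0 x)"
| "num_diff (num.Bit0 x) (num.Bit0 y) = shift_diff False False (num_diff x y)"
| "num_diff (num.Bit0 x) (num.Bit1 y) = shift_diff False True (num_diff x y)"
| "num_diff (num.Bit1 x) (num.Bit0 y) = shift_diff True False (num_diff x y)"
| "num_diff (num.Bit1 x) (num.Bit1 y) = shift_diff True True (num_diff x y)"

lemma numeral_Bit01:
  "(numeral (num.Bit0 x) :: int) = numeral x + numeral x"
  "(numeral (num.Bit1 x) :: int) = numeral x + numeral x + 1"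
  "(numeral (Num.BitM x) :: int) = numeral x + numeral x - 1"
  by (simp_all only: numeral_BitM numeral.simps)

lemma shift_diff:
  "diff_spec d k \<Longrightarrow> diff_spec (shift_diff x y d) (k + k + of_bool x - of_bool y)"
  by (cases x; cases y; cases d; simp only: shift_diff.simps diff_spec.simps of_bool_eq numeral_Bit01 numeral_One; linarith)

lemma num_diff: "diff_spec (num_diff x y) (numeral x - numeral y)"
proof (induction x y rule: num_diff.induct)
  case (6 x y)
  from shift_diff[OF this, of False False] show ?case
    by (simp only: num_diff.simps of_bool_eq numeral_Bit01 algebra_simps add_0_left add_0_right diff_0_right)
next
  case (7 x y)
  from shift_diff[OF this, of False True] show ?case
    by (simp only: num_diff.simps of_bool_eq numeral_Bit01 algebra_simps add_0_left add_0_right diff_0_right)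
next
  case (8 x y)
  from shift_diff[OF this, of True False] show ?case
    by (simp only: num_diff.simps of_bool_eq numeral_Bit01 algebra_simps add_0_left add_0_right diff_0_right)
next
  case (9 x y)
  from shift_diff[OF this, of True True] show ?case
    by (simp only: num_diff.simps of_bool_eq numeral_Bit01 algebra_simps add_0_left add_0_right diff_0_right)
qed simp_all

text \<open>
  Since \<^typ>\<open>num\<close> has no zero, residues modulo \<open>m\<close> are represented in \<open>{1..m}\<close>.
\<close>

definition repr :: "num \<Rightarrow> num \<Rightarrow> int \<Rightarrow> bool" where
  "repr m x k \<longleftrightarrow> (numeral x :: int) \<le> numeral m \<and> [numeral x = k] (mod numeral m)"

lemma repr_cong: "repr m x k \<Longrightarrow> [k = l] (mod numeral m) \<Longrightarrow> repr m x l"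
  unfolding repr_def by (blast intro: cong_trans)

lemma repr_One: "repr m num.One 1"
  by (simp add: repr_def)

lemma repr_self: "repr m m 0"
  by (simp add: repr_def cong_def)

text \<open>In the case \<open>Zero\<close> the kept \<open>x\<close> equals the modulus in both
  uses below, and so represents 0.\<close>

fun keep_diff :: "num \<Rightarrow> diff \<Rightarrow> num" where
  "keep_diff x Neg = x"
| "keep_diff x Zero = x"
| "keep_diff x (Pos z) = z"

definition add_mod :: "num \<Rightarrow> num \<Rightarrow> num \<Rightarrow> num" where
  "add_mod m x y = keep_diff (x + y) (num_diff (x + y) m)"

text \<open>Two representatives add up to at most \<open>2 * m\<close>, so a single subtraction of
  \<open>m\<close> suffices.\<close>

lemma add_mod:
  assumes "repr m x k" "repr m y l"
  shows "repr m (add_mod m x y) (k + l)"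
proof -
  have sum: "(numeral (x + y) :: int) = numeral x + numeral y"
    by (rule numeral_add)
  have c: "[numeral (x + y) = k + l] (mod (numeral m :: int))"
    unfolding sum using assms unfolding repr_def by (intro cong_add) auto
  have d: "diff_spec (num_diff (x + y) m) (numeral (x + y) - numeral m)"
    by (rule num_diff)
  have x: "(numeral x :: int) \<le> numeral m" and y: "(numeral y :: int) \<le> numeral m"
    using assms by (auto simp only: repr_def)
  show ?thesis
  proof (cases "num_diff (x + y) m")
    case (Pos z)
    with d have z: "(numeral z :: int) = numeral (x + y) - numeral m" by simp
    have "[numeral z = numeral (x + y)] (mod (numeral m :: int))"
      unfolding cong_iff_dvd_diff z by (rule dvdI[of _ _ "- 1"]) linarith
    with c have "[numeral z = k + l] (mod (numeral m :: int))" by (blast intro: cong_trans)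
    moreover have "(numeral z :: int) \<le> numeral m" using z sum x y by linarith
    ultimately show ?thesis using Pos by (simp add: add_mod_def repr_def)
  next
    case Neg
    with d have "(numeral (x + y) :: int) \<le> numeral m" by (simp only: diff_spec.simps; linarith)
    with c Neg show ?thesis by (simp add: add_mod_def repr_def)
  next
    case Zero
    with d have "(numeral (x + y) :: int) \<le> numeral m" by (simp only: diff_spec.simps; linarith)
    with c Zero show ?thesis by (simp add: add_mod_def repr_def)
  qed
qed

definition neg_mod :: "num \<Rightarrow> num \<Rightarrow> num" where
  "neg_mod m x = keep_diff m (num_diff m x)"

lemma neg_mod:
  assumes "repr m x k"
  shows "repr m (neg_mod m x) (- k)"
proof -
  have d: "diff_spec (num_diff m x) (numeral m - numeral x)"
    by (rule num_diff)
  have le: "(numeral x :: int) \<le> numeral m" and c: "[numeral x = k] (mod (numeral m :: int))"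
    using assms by (auto simp only: repr_def)
  from c obtain j where j: "k = (numeral x :: int) + numeral m * j"
    by (auto simp: cong_iff_lin)
  show ?thesis
  proof (cases "num_diff m x")
    case (Pos z)
    with d have z: "(numeral z :: int) = numeral m - numeral x" by (simp only: diff_spec.simps)
    have "[numeral z = - k] (mod (numeral m :: int))"
      unfolding cong_iff_dvd_diff z j by (rule dvdI[of _ _ "1 + j"]) (simp only: algebra_simps mult_1_right; linarith)
    moreover have "(numeral z :: int) \<le> numeral m"
      using z zero_less_numeral[of x, where 'a = int] by linarith
    ultimately show ?thesis using Pos by (simp add: neg_mod_def repr_def)
  next
    case Zero
    with d have "(numeral m :: int) = numeral x" by (simp only: diff_spec.simps; linarith)
    then have "[numeral m = - k] (mod (numeral m :: int))"
      \<comment> \<open>Here \<open>x\<close> and \<open>m\<close> agree, so \<open>m + k\<close> is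
        \<open>2 * m + m * j\<close>.\<close>
      unfolding cong_iff_dvd_diff j by (intro dvdI[of _ _ "2 + j"]) (simp only: algebra_simps; linarith)
    then show ?thesis using Zero by (simp add: neg_mod_def repr_def)
  next
    case Neg
    with d le show ?thesis by (simp only: diff_spec.simps; linarith)
  qed
qed

section \<open>Products, Fibonacci numbers and powers of two modulo m\<close>

fun mult_mod :: "num \<Rightarrow> num \<Rightarrow> num \<Rightarrow> num" where
  "mult_mod m x num.One = x"
| "mult_mod m x (num.Bit0 y) = mult_mod m (add_mod m x x) y"
| "mult_mod m x (num.Bit1 y) = add_mod m x (mult_mod m (add_mod m x x) y)"

lemma mult_mod: "repr m x k \<Longrightarrow> repr m (mult_mod m x y) (k * numeral y)"
proof (induction y arbitrary: x k)
  case (Bit0 y)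
  from Bit0.IH[OF add_mod[OF Bit0.prems Bit0.prems]] show ?case
    by (simp only: mult_mod.simps numeral_Bit01 distrib_left distrib_right)
next
  case (Bit1 y)
  from add_mod[OF Bit1.prems Bit1.IH[OF add_mod[OF Bit1.prems Bit1.prems]]] show ?case
    by (simp only: mult_mod.simps numeral_Bit01 distrib_left distrib_right mult_1_right add_ac)
qed simp

lemma mult_mod_repr: "repr m x k \<Longrightarrow> repr m y l \<Longrightarrow> repr m (mult_mod m x y) (k * l)"
proof (rule repr_cong[OF mult_mod])
  assume "repr m y l"
  then show "[k * numeral y = k * l] (mod numeral m)"
    unfolding repr_def by (auto intro: cong_mult)
qed

text \<open>
  The results of recursive calls are passed to auxiliary functions, so that innermost rewriting
  evaluates them only once.
\<close>

fun fib_mod_step :: "num \<Rightarrow> bool \<Rightarrow> num \<times> num \<Rightarrow> num \<times> num" where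
  "fib_mod_step m False (x, y) =
     (mult_mod m x (add_mod m y (add_mod m y (neg_mod m x))), add_mod m (mult_mod m x x) (mult_mod m y y))"
| "fib_mod_step m True (x, y) =
     (add_mod m (mult_mod m x x) (mult_mod m y y), mult_mod m y (add_mod m x (add_mod m x y)))"

fun fib_mod :: "num \<Rightarrow> num \<Rightarrow> num \<times> num" where
  "fib_mod m num.One = (num.One, num.One)"
| "fib_mod m (num.Bit0 k) = fib_mod_step m False (fib_mod m k)"
| "fib_mod m (num.Bit1 k) = fib_mod_step m True (fib_mod m k)"

text \<open>The doubling formulas, consequences of the addition formula \<open>fib_add\<close>;
  factors 2 are written as sums to match the calls of \<open>add_mod\<close>.\<close>

lemma fib_double:
  "int (fib (k + k)) = int (fib k) * (int (fib (Suc k)) + (int (fib (Suc k)) - int (fib k)))"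
  "int (fib (Suc (k + k))) = int (fib k) * int (fib k) + int (fib (Suc k)) * int (fib (Suc k))"
  "int (fib (Suc (Suc (k + k)))) = int (fib (Suc k)) * (int (fib k) + (int (fib k) + int (fib (Suc k))))"
proof -
  show *: "int (fib (Suc (k + k))) = int (fib k) * int (fib k) + int (fib (Suc k)) * int (fib (Suc k))"
    by (subst fib_add) simp
  show **: "int (fib (k + k)) = int (fib k) * (int (fib (Suc k)) + (int (fib (Suc k)) - int (fib k)))"
  proof (cases k)
    case (Suc j)
    have "fib (k + k) = fib (Suc (k + j))" by (simp add: Suc)
    also have "\<dots> = fib (Suc j) * fib (Suc k) + fib j * fib k" by (rule fib_add)
    finally show ?thesis by (simp add: Suc algebra_simps)
  qed simp
  have "int (fib (Suc (Suc (k + k)))) = int (fib (Suc (k + k))) + int (fib (k + k))" by simp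
  then show "int (fib (Suc (Suc (k + k)))) = int (fib (Suc k)) * (int (fib k) + (int (fib k) + int (fib (Suc k))))"
    unfolding * ** by (simp add: algebra_simps)
qed

lemma fib_mod:
  "repr m (fst (fib_mod m k)) (fib (numeral k)) \<and> repr m (snd (fib_mod m k)) (fib (Suc (numeral k)))"
proof (induction k)
  case One
  then show ?case by (simp add: repr_One)
next
  case (Bit0 k)
  obtain x y where xy: "fib_mod m k = (x, y)" by fastforce
  with Bit0 have x: "repr m x (fib (numeral k))" and y: "repr m y (fib (Suc (numeral k)))" by auto
  have s: "(numeral (num.Bit0 k) :: nat) = numeral k + numeral k" by (rule numeral_Bit0)
  show ?case unfolding s fib_double
    using mult_mod_repr[OF x add_mod[OF y add_mod[OF y neg_mod[OF x]]]]
      add_mod[OF mult_mod_repr[OF x x] mult_mod_repr[OF y y]]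
    by (simp add: xy)
next
  case (Bit1 k)
  obtain x y where xy: "fib_mod m k = (x, y)" by fastforce
  with Bit1 have x: "repr m x (fib (numeral k))" and y: "repr m y (fib (Suc (numeral k)))" by auto
  have s: "(numeral (num.Bit1 k) :: nat) = Suc (numeral k + numeral k)"
    by (simp only: numeral_Bit1 Suc_eq_plus1)
  show ?case unfolding s fib_double
    using mult_mod_repr[OF y add_mod[OF x add_mod[OF x y]]]
      add_mod[OF mult_mod_repr[OF x x] mult_mod_repr[OF y y]]
    by (simp add: xy del: fib.simps(3))
qed

fun pow2_mod_step :: "num \<Rightarrow> bool \<Rightarrow> num \<Rightarrow> num" where
  "pow2_mod_step m False x = mult_mod m x x"
| "pow2_mod_step m True x = mult_mod m x (add_mod m x x)"

fun pow2_mod :: "num \<Rightarrow> num \<Rightarrow> num" where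
  "pow2_mod m num.One = add_mod m num.One num.One"
| "pow2_mod m (num.Bit0 k) = pow2_mod_step m False (pow2_mod m k)"
| "pow2_mod m (num.Bit1 k) = pow2_mod_step m True (pow2_mod m k)"

lemma pow2_mod: "repr m (pow2_mod m k) (2 ^ numeral k)"
proof (induction k)
  case One
  show ?case using add_mod[OF repr_One repr_One]
    by (simp only: pow2_mod.simps pow2_mod_step.simps numeral_One power_one_right one_add_one)
next
  case (Bit0 k)
  show ?case using mult_mod_repr[OF Bit0 Bit0]
    by (simp only: pow2_mod.simps pow2_mod_step.simps power_numeral_even Let_def)
next
  case (Bit1 k)
  show ?case using mult_mod_repr[OF Bit1 add_mod[OF Bit1 Bit1]]
    by (simp only: pow2_mod.simps pow2_mod_step.simps power_numeral_odd Let_def mult_2 distrib_left distrib_right)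
qed

section \<open>Search trees\<close>

text \<open>
  A tree describes what is known about an integer \<open>k\<close>: at depth \<open>i\<close> the path belonging to \<open>k\<close> carries
  the residue of \<open>k\<close> modulo the \<open>i\<close>-th modulus. An empty list of children stands for an
  unexplored subtree, not for the absence of possibilities.
\<close>

datatype tree = Node "(num \<times> tree) list"

fun covers :: "num list \<Rightarrow> tree \<Rightarrow> int \<Rightarrow> bool" where
  "covers [] t k \<longleftrightarrow> True"
| "covers (m # ms) (Node ps) k \<longleftrightarrow> ps = [] \<or> (\<exists>p\<in>set ps. repr m (fst p) k \<and> covers ms (snd p) k)"

definition matches :: "num list \<Rightarrow> num \<times> tree \<Rightarrow> int \<Rightarrow> bool" where
  "matches ms p k \<longleftrightarrow> repr (hd ms) (fst p) k \<and> covers (tl ms) (snd p) k"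

lemma covers_empty: "covers ms (Node []) k"
  by (cases ms) auto

lemma covers_cong: "(\<And>m. m \<in> set ms \<Longrightarrow> [k = l] (mod numeral m)) \<Longrightarrow> covers ms t k \<Longrightarrow> covers ms t l"
proof (induction ms t k rule: covers.induct)
  case (2 m ms ps k)
  show ?case
  proof (cases "ps = []")
    case False
    with 2 obtain p where p: "p \<in> set ps" "repr m (fst p) k" "covers ms (snd p) k" by auto
    with 2 have "repr m (fst p) l" "covers ms (snd p) l" by (auto intro: repr_cong)
    with p show ?thesis by auto
  qed simp
qed simp

fun residues :: "tree \<Rightarrow> num list" where
  "residues (Node ps) = map fst ps"

text \<open>
  The search at one node runs over residues only; its outcome is a tree of selections along which
  the subtrees are followed afterwards. Rewriting visits the arguments of each redex, so carrying the
  subtrees through the innermost loop would be too slow.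
\<close>

datatype outcome = Miss | Unexplored | Hit | Branch "outcome list"

fun lookup :: "num list \<Rightarrow> num \<Rightarrow> outcome" and lookup' :: "bool \<Rightarrow> num list \<Rightarrow> num \<Rightarrow> outcome" where
  "lookup [] s = Miss"
| "lookup (x # xs) s = lookup' (x = s) xs s"
| "lookup' True xs s = Hit"
| "lookup' False xs s = lookup xs s"

lemma lookup: "lookup xs s = (if s \<in> set xs then Hit else Miss)"
proof (induction xs)
  case (Cons x xs)
  then show ?case by (cases "x = s") auto
qed simp

text \<open>Only trailing misses are dropped, so the remaining outcomes keep the positions of their
  children, and a node at which everything misses collapses to \<open>Miss\<close>.\<close>

fun trim :: "outcome \<Rightarrow> outcome list \<Rightarrow> outcome list" where
  "trim Miss [] = []"
| "trim x xs = x # xs"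

fun branch :: "outcome list \<Rightarrow> outcome" where
  "branch [] = Miss"
| "branch (x # xs) = Branch (x # xs)"

fun search :: "num list \<Rightarrow> num list list \<Rightarrow> num \<Rightarrow> outcome"
  and searches :: "num list \<Rightarrow> num list \<Rightarrow> num list list \<Rightarrow> num \<Rightarrow> outcome list" where
  "search xs [] s = lookup xs s"
| "search xs ([] # rss) s = Unexplored"
| "search xs ((r # rs) # rss) s = branch (searches xs (r # rs) rss s)"
| "searches xs [] rss s = []"
| "searches xs (r # rs) rss s = trim (search xs rss (s + r)) (searches xs rs rss s)"

text \<open>
  At most five residues in \<open>{1..m}\<close> are added to the initial value \<open>m\<close>, so the sum vanishes modulo
  \<open>m\<close> only if it is one of \<open>2 * m, \<dots>, 6 * m\<close>.
\<close>

definition multiples :: "num \<Rightarrow> num list" where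
  "multiples m = map ((*) m) [num.Bit0 num.One, num.Bit1 num.One, num.Bit0 (num.Bit0 num.One),
     num.Bit1 (num.Bit0 num.One), num.Bit0 (num.Bit1 num.One)]"

text \<open>The check succeeds only if every combination of classes is excluded by some modulus;
  hence \<open>False\<close> once the moduli run out. The selected subtrees pile up in
  \<open>us\<close> in reverse order.\<close>

function (sequential) check :: "num list \<Rightarrow> tree list \<Rightarrow> bool"
  and follow :: "num list \<Rightarrow> outcome \<Rightarrow> tree list \<Rightarrow> tree list \<Rightarrow> bool"
  and follows :: "num list \<Rightarrow> outcome list \<Rightarrow> (num \<times> tree) list \<Rightarrow> tree list \<Rightarrow> tree list \<Rightarrow> bool" where
  "check [] ts \<longleftrightarrow> False"
| "check (m # ms) ts \<longleftrightarrow> follow ms (search (multiples m) (map residues ts) m) ts []"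
| "follow ms Miss ts us \<longleftrightarrow> True"
| "follow ms Unexplored ts us \<longleftrightarrow> False"
| "follow ms Hit ts us \<longleftrightarrow> check ms (rev us)"
| "follow ms (Branch ss) [] us \<longleftrightarrow> False"
| "follow ms (Branch ss) (Node ps # ts) us \<longleftrightarrow> follows ms ss ps ts us"
| "follows ms [] ps ts us \<longleftrightarrow> True"
| "follows ms (s # ss) [] ts us \<longleftrightarrow> True"
| "follows ms (s # ss) ((r, t) # ps) ts us \<longleftrightarrow> follow ms s ts (t # us) \<and> follows ms ss ps ts us"
  by pat_completeness auto
termination
  \<comment> \<open>The first component places \<open>follow ms\<close> strictly between
    \<open>check ms\<close> and \<open>check (m # ms)\<close>.\<close>
  by (relation "inv_image (less_than <*lex*> less_than <*lex*> less_than)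
     (\<lambda>x. case x of Inl (ms, ts) \<Rightarrow> (2 * length ms, 0, 0)
        | Inr (Inl (ms, s, ts, us)) \<Rightarrow> (Suc (2 * length ms), length ts, 0)
        | Inr (Inr (ms, ss, ps, ts, us)) \<Rightarrow> (Suc (2 * length ms), length ts, Suc (length ss)))")
     auto

section \<open>Soundness of the search\<close>

lemma follows_searches:
  assumes "follows ms (searches xs (map fst ps) rss s) ps ts us" "(r, t) \<in> set ps"
  shows "follow ms (search xs rss (s + r)) ts (t # us)"
  using assms
proof (induction ps)
  case (Cons p ps)
  obtain r' t' where p: "p = (r', t')" by fastforce
  let ?h = "search xs rss (s + r')" and ?l = "searches xs (map fst ps) rss s"
  have "follow ms ?h ts (t' # us) \<and> follows ms ?l ps ts us"
  \<comment> \<open>This is the only case in which \<open>trim\<close> drops something, and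
    \<open>follow\<close> and \<open>follows\<close> are true of what is dropped.\<close>
  proof (cases "?h = Miss \<and> ?l = []")
    case True
    then show ?thesis by simp
  next
    case False
    then have "trim ?h ?l = ?h # ?l" by (cases ?h; cases ?l) auto
    with Cons.prems(1) p show ?thesis by simp
  qed
  with Cons p show ?case by auto
qed simp

lemma follow_branch:
  "follow ms (branch ss) (Node ps # ts) us \<longleftrightarrow> follows ms ss ps ts us"
  by (cases ss) auto

lemma follow_search_step:
  assumes "follow ms (search xs (map fst ps # rss) s) (Node ps # ts) us"
  shows "ps \<noteq> []" "(r, t) \<in> set ps \<Longrightarrow> follow ms (search xs rss (s + r)) ts (t # us)"
proof -
  from assms show ps: "ps \<noteq> []" by (cases ps) auto
  then have "search xs (map fst ps # rss) s = branch (searches xs (map fst ps) rss s)"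
    by (cases ps) auto
  with assms have "follows ms (searches xs (map fst ps) rss s) ps ts us"
    by (simp only: follow_branch)
  then show "(r, t) \<in> set ps \<Longrightarrow> follow ms (search xs rss (s + r)) ts (t # us)"
    by (rule follows_searches)
qed

text \<open>An unexplored node would be reached through any choice of children of the earlier nodes,
  and \<open>follow\<close> rejects the outcome \<open>Unexplored\<close>.\<close>

lemma follow_search_explored:
  "follow ms (search xs (map residues ts) s) ts us \<Longrightarrow> Node [] \<notin> set ts"
proof (induction ts arbitrary: s us)
  case (Cons t ts)
  obtain ps where t: "t = Node ps" by (cases t)
  with Cons.prems have *: "follow ms (search xs (map fst ps # map residues ts) s) (Node ps # ts) us" by simp
  from follow_search_step(1)[OF this] obtain r u where "(r, u) \<in> set ps" by (cases ps) auto
  from Cons.IH[OF follow_search_step(2)[OF * this]] follow_search_step(1)[OF *] t show ?case by auto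
qed simp

text \<open>The chosen children lead to the outcome \<open>Hit\<close>, at which
  \<open>follow\<close> demands the check of their subtrees.\<close>

lemma follow_search:
  assumes "follow ms (search xs (map residues ts) s) ts us"
    and "list_all2 (\<lambda>t p. \<exists>ps. t = Node ps \<and> p \<in> set ps) ts qs"
    and "foldl (+) s (map fst qs) \<in> set xs"
  shows "check ms (rev us @ map snd qs)"
  using assms
proof (induction ts arbitrary: s us qs)
  case (Cons t ts)
  from Cons.prems(2) obtain ps p qs' where *: "t = Node ps" "p \<in> set ps" "qs = p # qs'"
    "list_all2 (\<lambda>t p. \<exists>ps. t = Node ps \<and> p \<in> set ps) ts qs'"
    by (auto simp: list_all2_Cons1)
  from Cons.prems(1) * have "follow ms (search xs (map fst ps # map residues ts) s) (Node ps # ts) us" by simp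
  from follow_search_step(2)[OF this, of "fst p" "snd p"] *
  have "follow ms (search xs (map residues ts) (s + fst p)) ts (snd p # us)" by simp
  from Cons.IH[OF this *(4)] Cons.prems(3) * show ?case by simp
qed (simp add: lookup)

lemma multiples:
  assumes "[(numeral s :: int) = 0] (mod numeral m)" "(numeral m :: int) < numeral s"
    "(numeral s :: int) \<le> 6 * numeral m"
  shows "s \<in> set (multiples m)"
proof -
  from assms(1) obtain j where j: "(numeral s :: int) = numeral m * j"
    by (auto simp: cong_0_iff dvd_def)
  have "numeral m * 1 < (numeral m :: int) * j"
    using assms(2) j by (simp only: mult_1_right)
  then have "1 < j" by (subst (asm) mult_less_cancel_left_pos) auto
  moreover have "numeral m * j \<le> (numeral m :: int) * 6"
    using assms(3) j by (simp only: mult.commute)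
  then have "j \<le> 6" by (subst (asm) mult_le_cancel_left_pos) auto
  ultimately consider "j = 2" | "j = 3" | "j = 4" | "j = 5" | "j = 6" by linarith
  then show ?thesis
    by cases (use j in \<open>simp_all add: multiples_def\<close>)
qed

lemma sum_repr:
  assumes "list_all2 (\<lambda>p k. repr m (fst p) k) qs ks"
  shows "[(numeral (foldl (+) s (map fst qs)) :: int) = numeral s + sum_list ks] (mod numeral m)"
    "(numeral (foldl (+) s (map fst qs)) :: int) \<le> numeral s + int (length qs) * numeral m"
    "qs \<noteq> [] \<Longrightarrow> (numeral s :: int) < numeral (foldl (+) s (map fst qs))"
  using assms
proof (induction qs ks arbitrary: s rule: list_all2_induct)
  case (Cons p qs k ks)
  {
    case 1
    have "[(numeral (s + fst p) :: int) = numeral s + k] (mod numeral m)"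
      unfolding numeral_add using Cons(1) unfolding repr_def by (intro cong_add) auto
    then have "[numeral (s + fst p) + sum_list ks = numeral s + k + sum_list ks] (mod (numeral m :: int))"
      by (intro cong_add) auto
    with Cons.IH(1)[of "s + fst p"] show ?case by (auto simp: add.assoc intro: cong_trans)
  next
    case 2
    have "(numeral (fst p) :: int) \<le> numeral m" using Cons(1) by (simp add: repr_def)
    with Cons.IH(2)[of "s + fst p"] numeral_add[of s "fst p", where 'a = int] show ?case
      by (simp only: list.map foldl.simps length_Cons of_nat_Suc distrib_right; linarith)
  next
    case 3
    show ?case
    proof (cases "qs = []")
      case False
      with Cons.IH(3)[of "s + fst p"] show ?thesis
        using zero_less_numeral[of "fst p", where 'a = int] numeral_add[of s "fst p", where 'a = int]
        by (simp only: list.map foldl.simps; linarith)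
    next
      case True
      show ?thesis unfolding True
        using zero_less_numeral[of "fst p", where 'a = int] numeral_add[of s "fst p", where 'a = int]
        by (simp only: list.map foldl.simps; linarith)
    qed
  }
qed simp_all

text \<open>If the sum vanished, the actual residues of the \<open>ks\<close> would give a hit at
  the first modulus, so the check would hold for the selected subtrees and the remaining moduli, and
  finally for \<open>[]\<close>, where it is false.\<close>

lemma check_sound:
  assumes "check ms ts" "list_all2 (covers ms) ts ks" "ts \<noteq> []" "length ts \<le> 5"
  shows "sum_list ks \<noteq> 0"
  using assms
proof (induction ms arbitrary: ts)
  case (Cons m ms)
  show ?case
  proof
    assume sum: "sum_list ks = 0"
    have f: "follow ms (search (multiples m) (map residues ts) m) ts []"
      using Cons.prems(1) by simp
    from follow_search_explored[OF f] have explored: "Node [] \<notin> set ts" .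
    \<comment> \<open>\<open>qs\<close> selects for each integer a child carrying its residue; such
      a child exists because no node is unexplored.\<close>
    have "\<exists>qs. list_all2 (\<lambda>t p. \<exists>ps. t = Node ps \<and> p \<in> set ps) ts qs
      \<and> list_all2 (\<lambda>p k. repr m (fst p) k) qs ks \<and> list_all2 (covers ms) (map snd qs) ks"
      using Cons.prems(2) explored
    proof (induction ts ks rule: list_all2_induct)
      case (Cons t ts k ks)
      then obtain qs where qs: "list_all2 (\<lambda>t p. \<exists>ps. t = Node ps \<and> p \<in> set ps) ts qs"
        "list_all2 (\<lambda>p k. repr m (fst p) k) qs ks" "list_all2 (covers ms) (map snd qs) ks" by auto
      obtain ps where ps: "t = Node ps" "ps \<noteq> []" using Cons by (cases t) auto
      with Cons obtain p where "p \<in> set ps" "repr m (fst p) k" "covers ms (snd p) k" by auto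
      with qs ps show ?case by (intro exI[of _ "p # qs"]) auto
    qed simp
    then obtain qs where qs: "list_all2 (\<lambda>t p. \<exists>ps. t = Node ps \<and> p \<in> set ps) ts qs"
      "list_all2 (\<lambda>p k. repr m (fst p) k) qs ks" "list_all2 (covers ms) (map snd qs) ks" by blast
    have len: "length qs = length ts" using qs(1) by (simp add: list_all2_lengthD)
    then have ne: "qs \<noteq> []" using Cons.prems(3) by auto
    let ?s = "foldl (+) m (map fst qs)"
    have "?s \<in> set (multiples m)"
    proof (rule multiples)
      have "[(numeral m :: int) = 0] (mod numeral m)" by (simp add: cong_def)
      with sum_repr(1)[OF qs(2), of m] sum show "[(numeral ?s :: int) = 0] (mod numeral m)"
        by (auto intro: cong_trans)
      show "(numeral m :: int) < numeral ?s"  by (rule sum_repr(3)[OF qs(2) ne])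
      have "int (length qs) * numeral m \<le> 5 * numeral m"
        using Cons.prems(4) len by (intro mult_right_mono) auto
      with sum_repr(2)[OF qs(2), of m] show "(numeral ?s :: int) \<le> 6 * numeral m" by linarith
    qed
    from follow_search[OF f qs(1) this] have "check ms (map snd qs)" by simp
    from Cons.IH[OF this qs(3)] Cons.prems(4) len ne sum show False by auto
  qed
qed simp

section \<open>Tables of linear recurrences\<close>

text \<open>The flag lets Fibonacci-like and geometric sequences share the table construction, with
  a pair of consecutive terms as state in both cases.\<close>

definition recurrent :: "bool \<Rightarrow> (nat \<Rightarrow> int) \<Rightarrow> bool" where
  "recurrent d f \<longleftrightarrow> (if d then \<forall>i. f (Suc (Suc i)) = f i + f (Suc i) else \<forall>i. f (Suc i) = f i + f i)"

fun run :: "bool \<Rightarrow> num \<Rightarrow> num \<Rightarrow> num \<Rightarrow> tree list \<Rightarrow> (num \<times> tree) list" where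
  "run d m a b [] = []"
| "run True m a b (t # ts) = (a, t) # run True m b (add_mod m a b) ts"
| "run False m a b (t # ts) = (a, t) # run False m b (add_mod m b b) ts"

lemma length_run: "length (run d m a b ts) = length ts"
  by (induction d m a b ts rule: run.induct) auto

lemma run_nth:
  assumes "recurrent d f" "repr m a (f j)" "repr m b (f (Suc j))" "i < length ts"
  shows "repr m (fst (run d m a b ts ! i)) (f (j + i)) \<and> snd (run d m a b ts ! i) = ts ! i"
  using assms
proof (induction d m a b ts arbitrary: i j rule: run.induct)
  case (2 m a b t ts)
  from 2(2,3,4) have "repr m (add_mod m a b) (f (Suc (Suc j)))"
    using add_mod[of m a "f j" b "f (Suc j)"] by (simp add: recurrent_def)
  from 2(1)[OF 2(2) 2(4) this, of "i - 1"] 2(3,5) show ?case by (cases i) auto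
next
  case (3 m a b t ts)
  from 3(2,4) have "repr m (add_mod m b b) (f (Suc (Suc j)))"
    using add_mod[of m b "f (Suc j)" b "f (Suc j)"] by (simp add: recurrent_def)
  from 3(1)[OF 3(2) 3(4) this, of "i - 1"] 3(3,5) show ?case by (cases i) auto
qed simp

text \<open>
  A shift \<open>(x, y, z)\<close> by \<open>b\<close> represents the symmetric matrix taking \<open>(f i, f (i + 1))\<close> to
  \<open>(f (i + b), f (i + b + 1))\<close>.
\<close>

fun shift_step :: "num \<Rightarrow> num \<times> num \<Rightarrow> num \<times> num \<times> num" where
  "shift_step m (x, y) = (add_mod m y (neg_mod m x), x, y)"

text \<open>A scalar matrix, with \<open>m\<close> standing for the entries 0.\<close>

fun geometric_shift :: "num \<Rightarrow> num \<Rightarrow> num \<times> num \<times> num" where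
  "geometric_shift m x = (x, m, x)"

fun shift :: "bool \<Rightarrow> num \<Rightarrow> num \<Rightarrow> num \<times> num \<times> num" where
  "shift True m b = shift_step m (fib_mod m b)"
| "shift False m b = geometric_shift m (pow2_mod m b)"

fun shifts :: "num \<Rightarrow> (nat \<Rightarrow> int) \<Rightarrow> nat \<Rightarrow> num \<times> num \<times> num \<Rightarrow> bool" where
  "shifts m f b (x, y, z) \<longleftrightarrow> (\<exists>k l n. repr m x k \<and> repr m y l \<and> repr m z n \<and>
     (\<forall>i. f (i + b) = f i * k + f (Suc i) * l \<and> f (Suc (i + b)) = f i * l + f (Suc i) * n))"

text \<open>The entries are F(b-1), F(b), F(b+1); writing F(b-1) as a difference includes
  \<open>b = 0\<close>.\<close>

lemma fib_shift:
  assumes "recurrent True f"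
  shows "f (i + b) = f i * (int (fib (Suc b)) - int (fib b)) + f (Suc i) * int (fib b)"
    "f (Suc (i + b)) = f i * int (fib b) + f (Suc i) * int (fib (Suc b))"
proof (induction b)
  case (Suc b)
  {
    case 1
    show ?case using Suc.IH(2) by (simp add: algebra_simps)
  next
    case 2
    have "f (Suc (Suc (i + b))) = f (i + b) + f (Suc (i + b))"
      using assms by (simp add: recurrent_def)
    then show ?case using Suc.IH by (simp add: algebra_simps)
  }
qed auto

lemma pow2_shift:
  assumes "recurrent False f"
  shows "f (i + b) = f i * 2 ^ b"
  using assms by (induction b) (auto simp: recurrent_def)

lemma shift:
  assumes "recurrent d f"
  shows "shifts m f (numeral b) (shift d m b)"
proof (cases d)
  case True
  obtain x y where xy: "fib_mod m b = (x, y)" by fastforce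
  with fib_mod[of m b] have x: "repr m x (fib (numeral b))" and y: "repr m y (fib (Suc (numeral b)))" by auto
  have "recurrent True f" using assms True by simp
  from fib_shift[OF this, of _ "numeral b"] add_mod[OF y neg_mod[OF x]] x y show ?thesis
    by (auto simp: True xy simp del: fib.simps(3))
next
  case False
  have "recurrent False f" using assms False by simp
  from pow2_shift[OF this, of _ "numeral b"] pow2_shift[OF this, of "Suc _" "numeral b"]
    pow2_mod[of m b] repr_self[of m] show ?thesis
    by (force simp: False)
qed

text \<open>Jumping with the shift matrix gives the starting pair of each run without the terms in
  between.\<close>

fun seeds :: "num \<Rightarrow> num \<times> num \<times> num \<Rightarrow> num \<Rightarrow> num \<Rightarrow> unit list \<Rightarrow> (num \<times> num) list" where
  "seeds m s a b [] = []"
| "seeds m (x, y, z) a b (u # us) = (a, b) # seeds m (x, y, z)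
     (add_mod m (mult_mod m a x) (mult_mod m b y)) (add_mod m (mult_mod m a y) (mult_mod m b z)) us"

lemma seeds:
  assumes "shifts m f c s" "repr m a (f j)" "repr m b (f (Suc j))" "w < length us"
  shows "repr m (fst (seeds m s a b us ! w)) (f (j + c * w)) \<and> repr m (snd (seeds m s a b us ! w)) (f (Suc (j + c * w)))"
  using assms
proof (induction m s a b us arbitrary: j w rule: seeds.induct)
  case (2 m x y z a b u us)
  from 2(2) obtain k l n where *: "repr m x k" "repr m y l" "repr m z n"
    "\<And>i. f (i + c) = f i * k + f (Suc i) * l" "\<And>i. f (Suc (i + c)) = f i * l + f (Suc i) * n"
    by auto
  have "repr m (add_mod m (mult_mod m a x) (mult_mod m b y)) (f (j + c))"
    "repr m (add_mod m (mult_mod m a y) (mult_mod m b z)) (f (Suc (j + c)))"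
    unfolding *(4,5) using 2(3,4) *(1-3) by (auto intro: add_mod mult_mod_repr)
  from 2(1)[OF 2(2) this] 2(3-5) show ?case
    by (cases w) (auto simp: algebra_simps)
qed simp

lemma length_seeds: "length (seeds m s a b us) = length us"
  by (induction m s a b us rule: seeds.induct) auto

text \<open>
  Lengths are given by lists of units, over which rewriting can recurse without arithmetic.
\<close>

fun take_shape :: "unit list \<Rightarrow> 'a list \<Rightarrow> 'a list" where
  "take_shape (u # us) (x # xs) = x # take_shape us xs"
| "take_shape [] xs = []"
| "take_shape (u # us) [] = []"

fun drop_shape :: "'b list \<Rightarrow> 'a list \<Rightarrow> 'a list" where
  "drop_shape (u # us) (x # xs) = drop_shape us xs"
| "drop_shape [] xs = xs"
| "drop_shape (u # us) [] = []"

lemma take_shape: "take_shape us xs = take (length us) xs"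
  by (induction us xs rule: take_shape.induct) auto

lemma drop_shape: "drop_shape us xs = drop (length us) xs"
  by (induction us xs rule: drop_shape.induct) auto

fun runs :: "bool \<Rightarrow> num \<Rightarrow> unit list \<Rightarrow> (num \<times> num) list \<Rightarrow> tree list \<Rightarrow> (num \<times> tree) list" where
  "runs d m us [] ts = []"
| "runs d m us ((a, b) # ss) ts = run d m a b (take_shape us ts) @ runs d m us ss (drop_shape us ts)"

lemma length_runs: "length ts = length us * length ss \<Longrightarrow> length (runs d m us ss ts) = length ts"
  by (induction d m us ss ts rule: runs.induct) (auto simp: length_run take_shape drop_shape)

lemma runs_nth:
  assumes "recurrent d f" "length ts = length us * length ss" "x < length ts"
    and "\<And>w. w < length ss \<Longrightarrow> repr m (fst (ss ! w)) (f (j + c * w)) \<and> repr m (snd (ss ! w)) (f (Suc (j + c * w)))"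
  shows "repr m (fst (runs d m us ss ts ! x)) (f (j + c * (x div length us) + x mod length us))
    \<and> snd (runs d m us ss ts ! x) = ts ! x"
  using assms
proof (induction d m us ss ts arbitrary: x j rule: runs.induct)
  case (2 d m us a b ss ts)
  have us: "0 < length us" using 2(3,4) by (cases us) auto
  show ?case
  proof (cases "x < length us")
    case True
    have "repr m a (f j)" "repr m b (f (Suc j))" using 2(5)[of 0] by auto
    from run_nth[OF 2(2) this, of x "take_shape us ts"] True 2(3) show ?thesis
      by (auto simp: take_shape nth_append length_run)
  next
    case False
    have "repr m (fst (ss ! w)) (f (j + c + c * w)) \<and> repr m (snd (ss ! w)) (f (Suc (j + c + c * w)))"
      if "w < length ss" for w
      using 2(5)[of "Suc w"] that by (simp add: algebra_simps)
    from 2(1)[OF 2(2) _ _ this, of "x - length us"] False 2(3,4) us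
    have "repr m (fst (runs d m us ss (drop_shape us ts) ! (x - length us)))
        (f (j + c + c * ((x - length us) div length us) + (x - length us) mod length us))
      \<and> snd (runs d m us ss (drop_shape us ts) ! (x - length us)) = ts ! x"
      by (auto simp: drop_shape)
    moreover have "x div length us = Suc ((x - length us) div length us)"
      "(x - length us) mod length us = x mod length us"
      using False us by (auto simp: le_div_geq le_mod_geq)
    ultimately show ?thesis using False 2(3)
      by (auto simp: nth_append length_run take_shape algebra_simps)
  qed
qed simp

section \<open>Grouping the lifts of a class and padding with unexplored positions\<close>

fun zip_cons :: "'a list list \<Rightarrow> 'a list \<Rightarrow> 'a list list" where
  "zip_cons (r # rs) (x # xs) = (x # r) # zip_cons rs xs"
| "zip_cons [] xs = []"
| "zip_cons (r # rs) [] = []"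

text \<open>Positions of the next table that differ by multiples of \<open>length rs\<close> are
  lifts of the same class, so they become children of one node.\<close>

fun regroup :: "unit list \<Rightarrow> 'a list list \<Rightarrow> 'a list \<Rightarrow> 'a list list" where
  "regroup [] rs xs = rs"
| "regroup (u # us) rs xs = regroup us (zip_cons rs xs) (drop_shape rs xs)"

lemma zip_cons:
  "length rs \<le> length xs \<Longrightarrow> length (zip_cons rs xs) = length rs"
  "length rs \<le> length xs \<Longrightarrow> p < length rs \<Longrightarrow> zip_cons rs xs ! p = xs ! p # rs ! p"
proof (induction rs xs arbitrary: p rule: zip_cons.induct)
  case (1 r rs x xs)
  {
    case 1
    then show ?case using "1.IH"(1) by auto
  next
    case 2
    then show ?case using "1.IH"(2)[of "p - 1"] by (cases p) auto
  }
qed auto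

lemma length_regroup: "length xs = length us * length rs \<Longrightarrow> length (regroup us rs xs) = length rs"
  by (induction us rs xs rule: regroup.induct) (auto simp: drop_shape zip_cons)

text \<open>The inclusion says that entries already accumulated survive; it is what makes the
  induction go through.\<close>

lemma regroup_nth:
  assumes "length xs = length us * length rs" "p < length rs"
  shows "set (rs ! p) \<subseteq> set (regroup us rs xs ! p) \<and>
    (\<forall>u<length us. xs ! (p + length rs * u) \<in> set (regroup us rs xs ! p))"
  using assms
proof (induction us rs xs rule: regroup.induct)
  case (2 v us rs xs)
  have z: "length (zip_cons rs xs) = length rs" "zip_cons rs xs ! p = xs ! p # rs ! p"
    using 2(2,3) by (auto simp: zip_cons)
  have IH: "set (xs ! p # rs ! p) \<subseteq> set (regroup us (zip_cons rs xs) (drop_shape rs xs) ! p)"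
    "\<And>u. u < length us \<Longrightarrow> drop (length rs) xs ! (p + length rs * u)
       \<in> set (regroup us (zip_cons rs xs) (drop_shape rs xs) ! p)"
    using 2 z by (auto simp: drop_shape)
  have "xs ! (p + length rs * u) \<in> set (regroup us (zip_cons rs xs) (drop_shape rs xs) ! p)"
    if "u < Suc (length us)" for u
  proof (cases u)
    case 0
    then show ?thesis using IH(1) by auto
  next
    case (Suc u')
    have "drop (length rs) xs ! (p + length rs * u') = xs ! (p + length rs * u)"
      using 2(2) Suc by (subst nth_drop) (auto simp: algebra_simps)
    with IH(2)[of u'] that Suc show ?thesis by auto
  qed
  with IH(1) show ?case by auto
qed simp

function (sequential) pad :: "unit list \<Rightarrow> 'a list \<Rightarrow> 'a list \<Rightarrow> 'a list" where
  "pad (u # us) ys (x # xs) = take_shape (u # us) (x # xs) @ ys @ pad (u # us) ys (drop_shape us xs)"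
| "pad us ys xs = []"
  by pat_completeness auto
termination by (relation "measure (\<lambda>(us, ys, xs). length xs)") (auto simp: drop_shape)

lemma pad_Cons:
  "us \<noteq> [] \<Longrightarrow> xs \<noteq> [] \<Longrightarrow> pad us ys xs = take (length us) xs @ ys @ pad us ys (drop (length us) xs)"
  by (cases us; cases xs) (auto simp: take_shape drop_shape)

lemma pad_nth:
  assumes "us \<noteq> []" "length xs = length us * n"
  shows "length (pad us ys xs) = (length us + length ys) * n \<and>
    (\<forall>i v. i < length us \<longrightarrow> v < n \<longrightarrow>
      pad us ys xs ! (i + (length us + length ys) * v) = xs ! (i + length us * v)) \<and>
    (\<forall>i v. i < length ys \<longrightarrow> v < n \<longrightarrow>
      pad us ys xs ! (length us + i + (length us + length ys) * v) = ys ! i)"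
  using assms
proof (induction n arbitrary: xs)
  case 0
  then show ?case by (cases us) auto
next
  case (Suc n)
  let ?r = "length us" and ?e = "length ys" and ?p = "pad us ys (drop (length us) xs)"
  have r: "0 < ?r" using Suc.prems(1) by auto
  have p: "pad us ys xs = take ?r xs @ ys @ ?p"
    using Suc.prems by (intro pad_Cons) auto
  have IH: "length ?p = (?r + ?e) * n"
    "\<And>i v. i < ?r \<Longrightarrow> v < n \<Longrightarrow> ?p ! (i + (?r + ?e) * v) = drop ?r xs ! (i + ?r * v)"
    "\<And>i v. i < ?e \<Longrightarrow> v < n \<Longrightarrow> ?p ! (?r + i + (?r + ?e) * v) = ys ! i"
    using Suc.IH[of "drop ?r xs"] Suc.prems by auto
  have shift: "pad us ys xs ! (?r + ?e + y) = ?p ! y" for y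
    unfolding p using Suc.prems(2) by (simp add: nth_append)
  have A: "pad us ys xs ! (i + (?r + ?e) * v) = xs ! (i + ?r * v)" if "i < ?r" "v < Suc n" for i v
  proof (cases v)
    case 0
    then show ?thesis using that Suc.prems(2) unfolding p by (simp add: nth_append)
  next
    case (Suc v')
    have "i + (?r + ?e) * v = ?r + ?e + (i + (?r + ?e) * v')" using Suc by simp
    then have "pad us ys xs ! (i + (?r + ?e) * v) = ?p ! (i + (?r + ?e) * v')" by (simp only: shift)
    also have "\<dots> = drop ?r xs ! (i + ?r * v')" using IH(2) that Suc by simp
    also have "\<dots> = xs ! (i + ?r * v)"
      using Suc.prems(2) Suc by (subst nth_drop) (auto simp: algebra_simps)
    finally show ?thesis .
  qed
  have B: "pad us ys xs ! (?r + i + (?r + ?e) * v) = ys ! i" if "i < ?e" "v < Suc n" for i v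
  proof (cases v)
    case 0
    then show ?thesis using that Suc.prems(2) unfolding p by (simp add: nth_append)
  next
    case (Suc v')
    have "?r + i + (?r + ?e) * v = ?r + ?e + (?r + i + (?r + ?e) * v')" using Suc by simp
    then have "pad us ys xs ! (?r + i + (?r + ?e) * v) = ?p ! (?r + i + (?r + ?e) * v')" by (simp only: shift)
    with IH(3)[of i v'] that Suc show ?thesis by simp
  qed
  have "length (pad us ys xs) = (?r + ?e) * Suc n"
    unfolding p using IH(1) Suc.prems(2) by simp
  with A B show ?case by blast
qed

text \<open>
  A level \<open>(m, N, b, W, r, b', r', V, q, e)\<close> has modulus \<open>m\<close>, modulo which the sequence has period \<open>N\<close>.
  Its table consists of \<open>W\<close> runs of length \<open>r\<close>, the \<open>w\<close>-th run starting at index \<open>b * w\<close>. The remaining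
  entries describe the link to the next level, whose entries are collected in \<open>q\<close> rounds into the
  children of \<open>V\<close> runs of \<open>r'\<close> consecutive positions, with starting indices \<open>b'\<close> apart; each such run
  is followed by \<open>e\<close> positions that remain unexplored. On the last level \<open>q = 0\<close>.
\<close>

type_synonym level = "nat \<times> nat \<times> nat \<times> nat \<times> nat \<times> nat \<times> nat \<times> nat \<times> nat \<times> nat"

fun table :: "bool \<Rightarrow> (num \<Rightarrow> num \<times> num) \<Rightarrow> level list \<Rightarrow> (num \<times> tree) list"
  and row :: "bool \<Rightarrow> num \<Rightarrow> num \<times> num \<Rightarrow> nat \<Rightarrow> nat \<Rightarrow> nat \<Rightarrow> tree list \<Rightarrow> (num \<times> tree) list" where
  "table d init [] = []"
| "table d init ((m, N, b, W, r, b', r', V, q, e) # ls) =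
     row d (num_of_nat m) (init (num_of_nat m)) b W r
       (pad (replicate r' ()) (replicate e (Node []))
         (map Node (regroup (replicate q ()) (replicate (r' * V) []) (table d init ls))))"
| "row d m (x, y) b W r ts =
     runs d m (replicate r ()) (seeds m (shift d m (num_of_nat b)) x y (replicate W ())) ts"

definition position :: "nat \<Rightarrow> nat \<Rightarrow> nat \<Rightarrow> nat" where
  "position b r x = x mod r + b * (x div r)"

definition tabulates :: "(nat \<Rightarrow> int) \<Rightarrow> num list \<Rightarrow> nat \<Rightarrow> nat \<Rightarrow> nat \<Rightarrow> (num \<times> tree) list \<Rightarrow> bool" where
  "tabulates f ms N b r ps \<longleftrightarrow>
     (\<forall>x<length ps. \<forall>n. [n = position b r x] (mod N) \<longrightarrow> matches ms (ps ! x) (f n))"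

text \<open>The first disjunction makes position \<open>i + r' * w\<close> of the next table carry
  the index \<open>i + b' * w\<close>: the layouts agree, or the runs are contiguous, or one run is
  the whole table. The second makes position \<open>i + (r' + e) * v\<close> of the present table
  carry the index \<open>i + b' * v\<close>.\<close>

fun links :: "level \<Rightarrow> level \<Rightarrow> bool" where
  "links (m, N, b, W, r, b', r', V, q, e) (m2, N2, b2, W2, r2, _) \<longleftrightarrow>
     0 < q \<and> W2 * r2 = q * (r' * V) \<and> N2 = N * q \<and> b' * V = N \<and>
     (b2 = b' \<and> r2 = r' \<or> W2 = 1 \<and> b' = r' \<or> W2 = 1 \<and> r2 = r') \<and>
     (V = 1 \<and> r' \<le> r \<or> W = 1 \<and> b' = r' + e)"

fun linked :: "level list \<Rightarrow> bool" where
  "linked [] \<longleftrightarrow> True"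
| "linked [(m, N, b, W, r, b', r', V, q, e)] \<longleftrightarrow> q = 0"
| "linked (l # l2 # ls) \<longleftrightarrow> links l l2 \<and> linked (l2 # ls)"

fun proper :: "(nat \<Rightarrow> int) \<Rightarrow> (num \<Rightarrow> num \<times> num) \<Rightarrow> level \<Rightarrow> bool" where
  "proper f init (m, N, b, W, r, b', r', V, q, e) \<longleftrightarrow>
     0 < b \<and> 0 < r' \<and> (r' + e) * V = r * W \<and>
     repr (num_of_nat m) (fst (init (num_of_nat m))) (f 0) \<and>
     repr (num_of_nat m) (snd (init (num_of_nat m))) (f 1) \<and>
     (\<forall>i. [f (i + N) = f i] (mod (numeral (num_of_nat m))))"

fun modulus :: "level \<Rightarrow> num" where
  "modulus (m, _) = num_of_nat m"

section \<open>Correctness of the tables\<close>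

lemma period_cong:
  fixes f :: "nat \<Rightarrow> int"
  assumes "\<And>i. [f (i + N) = f i] (mod m)" "[n = n'] (mod N)"
  shows "[f n = f n'] (mod m)"
proof -
  have *: "[f (i + N * k) = f i] (mod m)" for i k
    by (induction k) (use assms(1)[of "i + N * _"] in \<open>auto simp: algebra_simps intro: cong_trans\<close>)
  from assms(2) obtain k l where "n' + k * N = n + l * N"
    by (auto simp: cong_iff_lin_nat)
  with *[of n' k] *[of n l] show ?thesis
    by (metis cong_sym cong_trans mult.commute)
qed

lemma cong_split:
  fixes n c N q :: nat
  assumes "[n = c] (mod N)" "0 < q"
  shows "\<exists>u<q. [n = c + N * u] (mod (N * q))"
proof -
  \<comment> \<open>The integers are used because \<open>c\<close> may exceed
    \<open>n\<close>.\<close>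
  from assms(1) have "[int c = int n] (mod int N)" by (simp add: cong_int_iff cong_sym_eq)
  then obtain t where t: "int n = int c + int N * t"
    by (auto simp: cong_iff_lin)
  define u where "u = nat (t mod int q)"
  have u: "int u = t mod int q" "u < q"
    using assms(2) by (auto simp: u_def nat_less_iff)
  have "int n = int (c + N * u) + int (N * q) * (t div int q)"
    using t mult_div_mod_eq[of "int q" t] u(1) by (simp add: algebra_simps flip: distrib_left)
  then have "[int (c + N * u) = int n] (mod int (N * q))"
    unfolding cong_iff_lin by blast
  then have "[n = c + N * u] (mod (N * q))"
    by (simp only: cong_int_iff cong_sym_eq)
  with u(2) show ?thesis by blast
qed

lemma position_less: "x < r \<Longrightarrow> position b r x = x"
  by (simp add: position_def)

lemma row_tabulates:
  assumes "recurrent d f" "0 < b" "length ts = r * W"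
    and "repr m (fst ab) (f 0)" "repr m (snd ab) (f 1)"
    and "\<And>i. [f (i + N) = f i] (mod (numeral m))"
    and "\<And>x n. x < length ts \<Longrightarrow> [n = position b r x] (mod N) \<Longrightarrow> covers ms (ts ! x) (f n)"
  shows "tabulates f (m # ms) N b r (row d m ab b W r ts)" "length (row d m ab b W r ts) = r * W"
proof -
  obtain x0 y0 where ab: "ab = (x0, y0)" by (cases ab)
  have b: "numeral (num_of_nat b) = b" using assms(2) by (simp add: numeral_num_of_nat)
  let ?ss = "seeds m (shift d m (num_of_nat b)) x0 y0 (replicate W ())"
  have s: "repr m (fst (?ss ! w)) (f (0 + b * w)) \<and> repr m (snd (?ss ! w)) (f (Suc (0 + b * w)))" if "w < length ?ss" for w
    using shift[OF assms(1), of m "num_of_nat b"] assms(4,5) that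
    unfolding b by (intro seeds) (auto simp: ab length_seeds)
  have len: "length ts = length (replicate r ()) * length ?ss"
    using assms(3) by (simp add: length_seeds)
  have row: "row d m ab b W r ts = runs d m (replicate r ()) ?ss ts"
    by (simp add: ab)
  then show "length (row d m ab b W r ts) = r * W"
    using length_runs[OF len] assms(3) by simp
  show "tabulates f (m # ms) N b r (row d m ab b W r ts)"
    unfolding tabulates_def row length_runs[OF len]
  proof (intro allI impI)
    fix x n assume x: "x < length ts" and n: "[n = position b r x] (mod N)"
    from runs_nth[OF assms(1) len x s]
    have "repr m (fst (runs d m (replicate r ()) ?ss ts ! x)) (f (position b r x))"
      "snd (runs d m (replicate r ()) ?ss ts ! x) = ts ! x"
      by (auto simp: position_def add.commute)
    moreover have "[f (position b r x) = f n] (mod numeral m)"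
      using period_cong[of f N "numeral m", OF assms(6) n] by (rule cong_sym)
    ultimately show "matches (m # ms) (runs d m (replicate r ()) ?ss ts ! x) (f n)"
      using assms(7)[OF x n] by (auto simp: matches_def intro: repr_cong)
  qed
qed

text \<open>The class of \<open>n\<close> modulo \<open>N\<close> splits into \<open>q\<close> lifts
  modulo \<open>N2\<close>. The lift containing \<open>n\<close> is an entry of the next table that
  \<open>regroup\<close> has placed among the children at \<open>x\<close>; padded positions cover
  everything.\<close>

lemma link_covers:
  assumes "links (m, N, b, W, r, b', r', V, q, e) (m2, N2, b2, W2, r2, k)"
    and "0 < r'" "(r' + e) * V = r * W"
    and "length ps = r2 * W2" "tabulates f ms N2 b2 r2 ps" "ms \<noteq> []"
    and ts: "ts = pad (replicate r' ()) (replicate e (Node []))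
         (map Node (regroup (replicate q ()) (replicate (r' * V) []) ps))"
  shows "length ts = r * W"
    and "x < length ts \<Longrightarrow> [n = position b r x] (mod N) \<Longrightarrow> covers ms (ts ! x) (f n)"
proof -
  let ?g = "regroup (replicate q ()) (replicate (r' * V) []) ps"
  have len: "length ps = length (replicate q ()) * length (replicate (r' * V) ([] :: (num \<times> tree) list))"
    using assms(1,4) by (simp add: mult.commute)
  have lg: "length ?g = r' * V" using length_regroup[OF len] by simp
  have p: "length ts = (r' + e) * V"
    "\<And>i v. i < r' \<Longrightarrow> v < V \<Longrightarrow> ts ! (i + (r' + e) * v) = Node (?g ! (i + r' * v))"
    "\<And>i v. i < e \<Longrightarrow> v < V \<Longrightarrow> ts ! (r' + i + (r' + e) * v) = Node []"
  proof -
    have gi: "i + r' * v < r' * V" if "i < r'" "v < V" for i v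
    proof -
      have "i + r' * v < r' * Suc v" using that by simp
      also have "\<dots> \<le> r' * V" using that by (intro mult_le_mono2) auto
      finally show ?thesis .
    qed
    have "replicate r' () \<noteq> []" "length (map Node ?g) = length (replicate r' ()) * V"
      using assms(2) lg by auto
    from pad_nth[OF this, of "replicate e (Node [])"]
    show "length ts = (r' + e) * V"
      "\<And>i v. i < r' \<Longrightarrow> v < V \<Longrightarrow> ts ! (i + (r' + e) * v) = Node (?g ! (i + r' * v))"
      "\<And>i v. i < e \<Longrightarrow> v < V \<Longrightarrow> ts ! (r' + i + (r' + e) * v) = Node []"
      unfolding ts using gi lg by auto
  qed
  then show "length ts = r * W" using assms(3) by simp
  assume x: "x < length ts" and n: "[n = position b r x] (mod N)"
  define i v where "i = x mod (r' + e)" and "v = x div (r' + e)"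
  have iv: "x = i + (r' + e) * v" "i < r' + e" "v < V"
    using assms(2) x p(1) by (auto simp: i_def v_def less_mult_imp_div_less mult.commute)
  show "covers ms (ts ! x) (f n)"
  proof (cases "i < r'")
    case False
    then have "i = r' + (i - r')" "i - r' < e" using iv(2) by auto
    then have "ts ! x = Node []" using p(3)[of "i - r'" v] iv by simp
    then show ?thesis by (simp add: covers_empty)
  next
    case True
    have pos: "position b r x = i + b' * v"
    proof -
      consider "V = 1" "r' \<le> r" | "W = 1" "b' = r' + e" using assms(1) by auto
      then show ?thesis
      proof cases
        case 1
        with iv True show ?thesis by (simp add: position_less)
      next
        case 2
        with x p(1) assms(3) iv(1) show ?thesis by (simp add: position_less)
      qed
    qed
    from assms(1) have q: "0 < q" and N2: "N2 = N * q" and N: "b' * V = N" by auto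
    from cong_split[OF n[unfolded pos] q] obtain u where
      u: "u < q" "[n = i + b' * v + N * u] (mod N2)" unfolding N2 by blast
    \<comment> \<open>Since \<open>N = b' * V\<close>, the lift by \<open>N * u\<close> amounts to
      moving \<open>V * u\<close> runs further.\<close>
    define w where "w = v + V * u"
    define y where "y = i + r' * w"
    have "i + b' * v + N * u = i + b' * w" unfolding w_def N[symmetric] by (simp add: algebra_simps)
    have iv': "i + r' * v < r' * V"
    proof -
      have "i + r' * v < r' * Suc v" using True by simp
      also have "\<dots> \<le> r' * V" using iv(3) by (intro mult_le_mono2) auto
      finally show ?thesis .
    qed
    have y: "y = (i + r' * v) + length (replicate (r' * V) ([] :: (num \<times> tree) list)) * u"
      by (simp add: y_def w_def algebra_simps)
    have "y < r' * V * Suc u" unfolding y using iv' by simp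
    also have "\<dots> \<le> r' * V * q" using u(1) by (intro mult_le_mono2) auto
    finally have y_less: "y < length ps" using len by (simp add: mult.commute)
    have "position b2 r2 y = i + b' * w"
    proof -
      consider "b2 = b'" "r2 = r'" | "W2 = 1" "b' = r'" | "W2 = 1" "r2 = r'" using assms(1) by auto
      then show ?thesis
      proof cases
        case 1
        with True show ?thesis by (simp add: position_def y_def)
      next
        case 2
        with y_less assms(4) show ?thesis by (simp add: position_less y_def)
      next
        case 3
        with y_less assms(4) have "y < r'" by simp
        then have "w = 0" by (cases w) (auto simp: y_def)
        with 3 \<open>y < r'\<close> show ?thesis by (simp add: position_less y_def)
      qed
    qed
    with u(2) \<open>i + b' * v + N * u = i + b' * w\<close> have "[n = position b2 r2 y] (mod N2)" by simp
    with assms(5) y_less have m: "matches ms (ps ! y) (f n)" by (auto simp: tabulates_def)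
    have "ps ! y \<in> set (?g ! (i + r' * v))"
      using regroup_nth[OF len, of "i + r' * v"] iv' u(1) unfolding y by auto
    with m assms(6) have "covers ms (Node (?g ! (i + r' * v))) (f n)"
      by (cases ms) (auto simp: matches_def)
    with p(2)[OF True iv(3)] iv(1) show ?thesis by simp
  qed
qed

lemma table_tabulates:
  assumes "recurrent d f" "linked ((m, N, b, W, r, k) # ls)"
    and "\<And>l. l \<in> set ((m, N, b, W, r, k) # ls) \<Longrightarrow> proper f init l"
  shows "tabulates f (map modulus ((m, N, b, W, r, k) # ls)) N b r (table d init ((m, N, b, W, r, k) # ls))
    \<and> length (table d init ((m, N, b, W, r, k) # ls)) = r * W"
  using assms(2,3)
proof (induction ls arbitrary: m N b W r k)
  case Nil
  obtain b' r' V q e where k: "k = (b', r', V, q, e)" by (cases k)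
  have valid: "proper f init (m, N, b, W, r, b', r', V, q, e)" using Nil(2) k by (simp del: proper.simps)
  let ?ts = "pad (replicate r' ()) (replicate e (Node []))
         (map Node (regroup (replicate q ()) (replicate (r' * V) []) []))"
  have q: "q = 0" using Nil(1) k by simp
  have pad: "length ?ts = (r' + e) * V"
    using pad_nth[of "replicate r' ()" "replicate (r' * V) (Node [])" V "replicate e (Node [])"] valid q
    by auto
  \<comment> \<open>With \<open>q = 0\<close> all child lists are empty, and padding only inserts
    further copies of \<open>Node []\<close>.\<close>
  have sub: "set (pad us (replicate e (Node [])) xs) \<subseteq> {Node []}" if "set xs \<subseteq> {Node []}" for us and xs :: "tree list"
    using that
  proof (induction us "replicate e (Node [])" xs rule: pad.induct)
    case (1 u us x xs)
    have "set (take_shape (u # us) (x # xs)) \<subseteq> {Node []}" "set (drop_shape us xs) \<subseteq> {Node []}"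
      using 1(2) set_take_subset[of "length us" xs] set_drop_subset[of "length us" xs]
      by (auto simp: take_shape drop_shape)
    with 1(1) show ?case by auto
  qed auto
  have "set ?ts \<subseteq> {Node []}" by (rule sub) (auto simp: q)
  then have cov: "covers ms (?ts ! x) z" if "x < length ?ts" for x ms z
    using that nth_mem[OF that] covers_empty by fastforce
  show ?case unfolding k table.simps list.map modulus.simps
    using row_tabulates[OF assms(1), of b ?ts r W "num_of_nat m" "init (num_of_nat m)" N "[]"] valid pad cov
    by simp
next
  case (Cons l2 ls)
  obtain b' r' V q e where k: "k = (b', r', V, q, e)" by (cases k)
  obtain m2 N2 b2 W2 r2 k2 where l2: "l2 = (m2, N2, b2, W2, r2, k2)" by (cases l2)
  have valid: "proper f init (m, N, b, W, r, b', r', V, q, e)" using Cons(3) k by (simp del: proper.simps)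
  have link: "links (m, N, b, W, r, b', r', V, q, e) (m2, N2, b2, W2, r2, k2)"
    using Cons(2) k l2 by simp
  have "tabulates f (map modulus (l2 # ls)) N2 b2 r2 (table d init (l2 # ls))
    \<and> length (table d init (l2 # ls)) = r2 * W2"
    unfolding l2 using Cons(2,3) l2 by (intro Cons.IH) (auto simp del: proper.simps links.simps)
  then have IH: "tabulates f (map modulus (l2 # ls)) N2 b2 r2 (table d init (l2 # ls))"
    "length (table d init (l2 # ls)) = r2 * W2" by auto
  have pr: "0 < r'" "(r' + e) * V = r * W" using valid by auto
  note cov = link_covers[OF link pr IH(2,1) _ refl]
  have init: "0 < b" "repr (num_of_nat m) (fst (init (num_of_nat m))) (f 0)"
    "repr (num_of_nat m) (snd (init (num_of_nat m))) (f 1)"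
    "\<And>i. [f (i + N) = f i] (mod numeral (num_of_nat m))"
    using valid by auto
  show ?case
    using row_tabulates[OF assms(1) init(1) cov(1) init(2-4) cov(2)] by (simp add: k)
qed

section \<open>The sieve\<close>

text \<open>
  The moduli are products of powers of two and of the primes 3, 5, 7, 11, 31, 41, 61, 101, 151, 241, 401, 601,
  641, 769, 1601, 12289, 15361, 25601, 61441, for which the Pisano period and the order of 2
  are smooth. From \<open>N = 1200\<close> on, only the classes of \<open>-19, \<dots>, 19\<close> (and at first their translates by
  \<open>N / 2\<close>) are refined for the Fibonacci numbers, and only those of \<open>4, \<dots>, 12\<close> for the exponents.
\<close>

definition fib_levels :: "level list" where
  "fib_levels =
    [(4, 6, 1, 1, 6, 6, 6, 1, 5, 0),
     (31, 30, 1, 1, 30, 30, 30, 1, 1, 0),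
     (11, 30, 1, 1, 30, 30, 30, 1, 4, 0),
     (3280, 120, 1, 1, 120, 120, 120, 1, 1, 0),
     (549, 120, 1, 1, 120, 120, 120, 1, 2, 0),
     (53984, 240, 1, 1, 240, 240, 240, 1, 5, 0),
     (3775, 1200, 1, 1, 1200, 1200, 1200, 1, 1, 0),
     (24341101, 1200, 1, 1, 1200, 600, 39, 2, 8, 561),
     (10492723456, 9600, 600, 16, 39, 9600, 39, 1, 1, 585),
     (492929, 9600, 1, 1, 39, 9600, 39, 1, 4, 0),
     (15729664, 38400, 9600, 4, 39, 38400, 39, 1, 4, 117),
     (50335744, 153600, 38400, 4, 39, 153600, 39, 1, 2, 117),
     (503324672, 307200, 153600, 2, 39, 1, 78, 1, 0, 0)]"

text \<open>The moduli are those of \<open>fib_levels\<close>, because \<open>check\<close> descends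
  all trees in step. Every period divides 153600.\<close>

definition pow_levels :: "level list" where
  "pow_levels =
    [(4, 1, 1, 1, 1, 1, 1, 1, 5, 0),
     (31, 5, 1, 1, 5, 5, 5, 1, 2, 0),
     (11, 10, 1, 1, 10, 10, 10, 1, 2, 0),
     (3280, 20, 1, 1, 20, 20, 20, 1, 3, 0),
     (549, 60, 1, 1, 60, 60, 60, 1, 2, 0),
     (53984, 120, 1, 1, 120, 120, 120, 1, 1, 0),
     (3775, 120, 1, 1, 120, 120, 120, 1, 5, 0),
     (24341101, 600, 1, 1, 600, 600, 9, 1, 2, 591),
     (10492723456, 1200, 600, 2, 9, 1200, 9, 1, 8, 9),
     (492929, 9600, 1200, 8, 9, 9600, 9, 1, 2, 63),
     (15729664, 19200, 9600, 2, 9, 19200, 9, 1, 8, 9),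
     (50335744, 153600, 19200, 8, 9, 153600, 9, 1, 1, 63),
     (503324672, 153600, 1, 1, 9, 1, 9, 1, 0, 0)]"

text \<open>Congruence modulo the period 0 is equality, so these exponents are kept exactly; each
  has a single lift to the next level.\<close>

definition small_levels :: "level list" where
  "small_levels = map (\<lambda>m. (m, 0, 1, 1, 13, 0, 13, 1, 1, 0))
     [4, 31, 11, 3280, 549, 53984, 3775, 24341101, 10492723456, 492929, 15729664, 50335744]
     @ [(503324672, 0, 1, 1, 13, 0, 13, 1, 0, 0)]"

fun twice :: "num \<Rightarrow> num \<Rightarrow> num \<times> num" where
  "twice m x = (x, add_mod m x x)"

text \<open>These are F(-19) = 4181 and F(-18) = -2584.\<close>

definition fib_init :: "num \<Rightarrow> num \<times> num" where
  "fib_init m = (mult_mod m num.One (num_of_nat 4181), neg_mod m (mult_mod m num.One (num_of_nat 2584)))"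

text \<open>Powers enter with a minus sign, so that a solution becomes a vanishing sum of five
  terms.\<close>

definition pow_init :: "num \<Rightarrow> num \<times> num" where
  "pow_init m = twice m (neg_mod m (pow2_mod m (num_of_nat 153604)))"

definition small_init :: "num \<Rightarrow> num \<times> num" where
  "small_init m = twice m (neg_mod m num.One)"

text \<open>
  The sequences are shifted so that the classes to be refined come first: \<open>fib_seq i = F (i - 19)\<close>,
  and \<open>pow_seq i\<close> agrees with \<open>- (2 ^ (i + 4))\<close> modulo all moduli for \<open>i \<ge> 9\<close>, since \<open>153600\<close> is a common period.
\<close>

definition fib_seq :: "nat \<Rightarrow> int" where
  "fib_seq i = 4181 * int (fib (Suc i)) - 6765 * int (fib i)"

definition pow_seq :: "nat \<Rightarrow> int" where
  "pow_seq i = - (2 ^ (153604 + i))"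

definition small_seq :: "nat \<Rightarrow> int" where
  "small_seq i = - (2 ^ i)"

lemma recurrent_seqs: "recurrent True fib_seq" "recurrent False pow_seq" "recurrent False small_seq"
  unfolding recurrent_def fib_seq_def pow_seq_def small_seq_def add_Suc_right power_Suc by auto

section \<open>Initial values and periods\<close>

lemma fib_19: "fib 19 = 4181" "fib (Suc 19) = 6765"
proof -
  have *: "fib 9 = 34" "fib (Suc 9) = 55" "fib (Suc 10) = 89"
    by (simp_all add: eval_nat_numeral)
  from fib_add[of 9 9] fib_add[of 10 9] * show "fib 19 = 4181" "fib (Suc 19) = 6765"
    by simp_all
qed

text \<open>After expanding by the addition formula, F(n+1) cancels and F(n) has the coefficient
  \<open>4181 * 4181 - 6765 * 2584 = 1\<close>, an instance of Cassini's identity.\<close>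

lemma fib_seq_shift: "fib_seq (n + 19) = int (fib n)"
proof -
  have "int (fib (n + 19)) = int (fib n) * 2584 + int (fib (Suc n)) * 4181"
    "int (fib (Suc (n + 19))) = int (fib n) * 4181 + int (fib (Suc n)) * 6765"
    using fib_shift[of "\<lambda>i. int (fib i)" n 19] fib_19
    by (simp_all add: recurrent_def)
  then show ?thesis by (simp add: fib_seq_def)
qed

lemma pow2_twice: "repr m x k \<Longrightarrow> repr m (fst (twice m x)) k \<and> repr m (snd (twice m x)) (k + k)"
  using add_mod[of m x k x k] by simp

lemma num_of_nat_eval: "num_of_nat 1 = num.One" "num_of_nat (numeral k) = k"
  by (simp_all add: num_of_nat_numeral_eq)

lemma init_seqs:
  "repr m (fst (fib_init m)) (fib_seq 0)" "repr m (snd (fib_init m)) (fib_seq 1)"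
  "repr m (fst (pow_init m)) (pow_seq 0)" "repr m (snd (pow_init m)) (pow_seq 1)"
  "repr m (fst (small_init m)) (small_seq 0)" "repr m (snd (small_init m)) (small_seq 1)"
proof -
  have "repr m (mult_mod m num.One (num_of_nat 4181)) (1 * 4181)"
    "repr m (mult_mod m num.One (num_of_nat 2584)) (1 * 2584)"
    using mult_mod[OF repr_One, of m] by (simp_all only: num_of_nat_eval)
  from this(1) neg_mod[OF this(2)]
  show "repr m (fst (fib_init m)) (fib_seq 0)" "repr m (snd (fib_init m)) (fib_seq 1)"
    by (simp_all add: fib_init_def fib_seq_def)
  have "repr m (pow2_mod m (num_of_nat 153604)) (2 ^ 153604)"
    using pow2_mod[of m "num_of_nat 153604"] by (simp only: num_of_nat_eval)
  from pow2_twice[OF neg_mod[OF this]]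
  show "repr m (fst (pow_init m)) (pow_seq 0)" "repr m (snd (pow_init m)) (pow_seq 1)"
    by (simp_all only: pow_init_def pow_seq_def add_0_right power_add power_one_right mult_2_right minus_add_distrib)
  from pow2_twice[OF neg_mod[OF repr_One]]
  show "repr m (fst (small_init m)) (small_seq 0)" "repr m (snd (small_init m)) (small_seq 1)"
    by (simp_all add: small_init_def small_seq_def)
qed

fun sized :: "level \<Rightarrow> bool" where
  "sized (m, N, b, W, r, b', r', V, q, e) \<longleftrightarrow> 0 < b \<and> 0 < r' \<and> (r' + e) * V = r * W"

fun fib_period :: "level \<Rightarrow> bool" where
  "fib_period (m, N, _) \<longleftrightarrow> fib_mod (num_of_nat m) (num_of_nat N) = (num_of_nat m, num.One)"

text \<open>Some moduli are even, so powers of two are only eventually periodic; periodicity is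
  tested from exponent 13 on.\<close>

fun pow2_period :: "level \<Rightarrow> bool" where
  "pow2_period (m, N, _) \<longleftrightarrow>
     mult_mod (num_of_nat m) (pow2_mod (num_of_nat m) (num_of_nat 13)) (pow2_mod (num_of_nat m) (num_of_nat N))
       = pow2_mod (num_of_nat m) (num_of_nat 13)"

text \<open>The matrix of the shift by \<open>N\<close> is congruent to the identity.\<close>

lemma fib_period:
  assumes "fib_mod m (num_of_nat N) = (m, num.One)" "0 < N"
  shows "[fib_seq (i + N) = fib_seq i] (mod numeral m)"
proof -
  have N: "numeral (num_of_nat N) = N" using assms(2) by (simp add: numeral_num_of_nat)
  have "repr m m (int (fib N))" "repr m num.One (int (fib (Suc N)))"
    using fib_mod[of m "num_of_nat N"] assms(1) unfolding N by auto
  then have *: "[int (fib N) = 0] (mod numeral m)" "[int (fib (Suc N)) = 1] (mod numeral m)"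
    by (auto simp: repr_def cong_def)
  have "[fib_seq i * (int (fib (Suc N)) - int (fib N)) + fib_seq (Suc i) * int (fib N)
      = fib_seq i * (1 - 0) + fib_seq (Suc i) * 0] (mod numeral m)"
    by (intro cong_add cong_mult cong_diff cong_refl *)
  then show ?thesis
    using fib_shift(1)[OF recurrent_seqs(1), of i N] by simp
qed

lemma pow2_period:
  assumes "mult_mod m (pow2_mod m (num_of_nat 13)) (pow2_mod m (num_of_nat N)) = pow2_mod m (num_of_nat 13)" "0 < N"
  shows "[2 ^ (13 + (i + N)) = (2 ^ (13 + i) :: int)] (mod numeral m)"
proof -
  have N: "numeral (num_of_nat N) = N" using assms(2) by (simp add: numeral_num_of_nat)
  have *: "repr m (pow2_mod m (num_of_nat 13)) (2 ^ 13)" "repr m (pow2_mod m (num_of_nat N)) (2 ^ N)"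
    using pow2_mod[of m "num_of_nat 13"] pow2_mod[of m "num_of_nat N"]
    unfolding N by (simp_all only: num_of_nat_eval)
  from mult_mod_repr[OF this] *(1) have "[2 ^ 13 * 2 ^ N = (2 ^ 13 :: int)] (mod numeral m)"
    unfolding assms(1) repr_def by (blast intro: cong_trans cong_sym)
  from cong_mult[OF this cong_refl[of "2 ^ i"]] show ?thesis
    by (simp only: power_add mult_ac)
qed

lemma pow_seq_period:
  assumes "mult_mod m (pow2_mod m (num_of_nat 13)) (pow2_mod m (num_of_nat N)) = pow2_mod m (num_of_nat 13)" "0 < N"
  shows "[pow_seq (i + N) = pow_seq i] (mod numeral m)"
proof -
  have e: "153604 + (i + N) = 13 + ((153591 + i) + N)" "153604 + i = 13 + (153591 + i)" by auto
  show ?thesis unfolding pow_seq_def e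
    using pow2_period[OF assms, of "153591 + i"] by (simp only: cong_minus_minus_iff)
qed

section \<open>Evaluation of the tables\<close>

fun double :: "'a list \<Rightarrow> 'a list" where
  "double xs = xs @ xs"

fun copies :: "num \<Rightarrow> 'a \<Rightarrow> 'a list" where
  "copies num.One x = [x]"
| "copies (num.Bit0 k) x = double (copies k x)"
| "copies (num.Bit1 k) x = x # double (copies k x)"

lemma replicate_eval: "replicate 0 x = []" "replicate 1 x = [x]" "replicate (numeral k) x = copies k x"
proof -
  show "replicate (numeral k) x = copies k x"
  proof (induction k)
    case (Bit0 k)
    then show ?case by (simp only: numeral_Bit0 replicate_add copies.simps double.simps)
  next
    case (Bit1 k)
    have "(numeral (num.Bit1 k) :: nat) = Suc (numeral k + numeral k)"
      by (simp only: numeral_Bit1 Suc_eq_plus1)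
    with Bit1 show ?case by (simp only: replicate.simps replicate_add copies.simps double.simps)
  qed simp
qed simp_all

lemmas mod_eval =
  num_of_nat_eval shift_diff.simps num_diff.simps BitM.simps keep_diff.simps add_mod_def neg_mod_def
  mult_mod.simps fib_mod_step.simps fib_mod.simps pow2_mod_step.simps pow2_mod.simps
  add_num_simps mult_num_simps num.inject num.distinct prod.inject simp_thms

lemmas table_eval =
  run.simps shift_step.simps geometric_shift.simps shift.simps seeds.simps take_shape.simps drop_shape.simps
  runs.simps zip_cons.simps regroup.simps pad.simps table.simps row.simps twice.simps fib_init_def pow_init_def
  small_init_def double.simps copies.simps replicate_eval list.map append.simps
  mult_1_right numeral_times_numeral

lemmas check_eval =
  residues.simps fst_conv multiples_def lookup.simps lookup'.simps trim.simps branch.simps search.simps searches.simps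
  check.simps follow.simps follows.simps rev.simps

lemma levels_sized:
  "list_all sized fib_levels" "list_all sized pow_levels" "list_all sized small_levels"
  "list_all (\<lambda>l. 0 < fst (snd l)) fib_levels" "list_all (\<lambda>l. 0 < fst (snd l)) pow_levels"
  "list_all (\<lambda>l. fst (snd l) = 0) small_levels"
  by (simp_all add: fib_levels_def pow_levels_def small_levels_def)

lemma levels_linked: "linked fib_levels" "linked pow_levels" "linked small_levels"
  by (simp_all add: fib_levels_def pow_levels_def small_levels_def)

lemma levels_period: "list_all fib_period fib_levels" "list_all pow2_period pow_levels"
  by (simp_all only: fib_levels_def pow_levels_def list.pred_inject fib_period.simps pow2_period.simps mod_eval)

section \<open>Cases by the number of exponents below 13\<close>

fun pairs :: "'a list \<Rightarrow> ('a \<times> 'a) list" where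
  "pairs [] = []"
| "pairs (x # xs) = map (Pair x) (x # xs) @ pairs xs"

lemma pairs: "x \<in> set xs \<Longrightarrow> y \<in> set xs \<Longrightarrow> (x, y) \<in> set (pairs xs) \<or> (y, x) \<in> set (pairs xs)"
  by (induction xs) auto

text \<open>Unordered pairs suffice because the sum is symmetric; singleton trees fix the
  first-level classes of both terms.\<close>

fun check_pairs :: "num list \<Rightarrow> tree list \<Rightarrow> ((num \<times> tree) \<times> (num \<times> tree)) list \<Rightarrow> tree list \<Rightarrow> bool" where
  "check_pairs ms ts [] us \<longleftrightarrow> True"
| "check_pairs ms ts ((x, y) # ps) us \<longleftrightarrow> check ms (ts @ [Node [x], Node [y]] @ us) \<and> check_pairs ms ts ps us"

fun check_pairs2 :: "num list \<Rightarrow> ((num \<times> tree) \<times> (num \<times> tree)) list \<Rightarrow> ((num \<times> tree) \<times> (num \<times> tree)) list \<Rightarrow> tree list \<Rightarrow> bool" where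
  "check_pairs2 ms [] ps us \<longleftrightarrow> True"
| "check_pairs2 ms ((x, y) # qs) ps us \<longleftrightarrow> check_pairs ms [Node [x], Node [y]] ps us \<and> check_pairs2 ms qs ps us"

lemma check_pairs: "check_pairs ms ts ps us \<Longrightarrow> (x, y) \<in> set ps \<Longrightarrow> check ms (ts @ [Node [x], Node [y]] @ us)"
  by (induction ms ts ps us rule: check_pairs.induct) auto

lemma check_pairs2: "check_pairs2 ms qs ps us \<Longrightarrow> (x, y) \<in> set qs \<Longrightarrow> check_pairs ms [Node [x], Node [y]] ps us"
  by (induction ms qs ps us rule: check_pairs2.induct) auto

text \<open>The digit in the names of the sieves counts the exponents that are at least 13.\<close>

fun sieve3 :: "num list \<Rightarrow> (num \<times> tree) list \<Rightarrow> (num \<times> tree) list \<Rightarrow> bool" where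
  "sieve3 ms F P \<longleftrightarrow> check_pairs ms [] (pairs F) [Node P, Node P, Node P]"

fun sieve2 :: "num list \<Rightarrow> (num \<times> tree) list \<Rightarrow> (num \<times> tree) list \<Rightarrow> (num \<times> tree) list \<Rightarrow> bool" where
  "sieve2 ms F P E \<longleftrightarrow> check_pairs ms [Node E] (pairs F) [Node P, Node P]"

fun sieve1 :: "num list \<Rightarrow> (num \<times> tree) list \<Rightarrow> (num \<times> tree) list \<Rightarrow> (num \<times> tree) list \<Rightarrow> bool" where
  "sieve1 ms F P E \<longleftrightarrow> check_pairs2 ms (pairs E) (pairs F) [Node P]"

definition moduli :: "num list" where
  "moduli = map modulus fib_levels"

definition fib_table :: "(num \<times> tree) list" where
  "fib_table = table True fib_init fib_levels"

definition pow_table :: "(num \<times> tree) list" where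
  "pow_table = table False pow_init pow_levels"

definition small_table :: "(num \<times> tree) list" where
  "small_table = table False small_init small_levels"

lemmas sieve_eval =
  moduli_def fib_table_def pow_table_def small_table_def fib_levels_def pow_levels_def small_levels_def modulus.simps
  mod_eval table_eval check_eval pairs.simps check_pairs.simps check_pairs2.simps sieve3.simps sieve2.simps sieve1.simps

lemma sieve3: "sieve3 moduli fib_table pow_table"
  by (simp only: sieve_eval)

lemma sieve2: "sieve2 moduli fib_table pow_table small_table"
  by (simp only: sieve_eval)

lemma sieve1: "sieve1 moduli fib_table pow_table small_table"
  by (simp only: sieve_eval)

section \<open>From the sieve to the bound on the exponents\<close>

lemma moduli: "moduli = map modulus pow_levels" "moduli = map modulus small_levels"
  by (simp_all add: moduli_def fib_levels_def pow_levels_def small_levels_def)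

lemma moduli_nonempty: "moduli \<noteq> []"
  by (simp add: moduli_def fib_levels_def)

lemma proper_levels:
  "l \<in> set fib_levels \<Longrightarrow> proper fib_seq fib_init l"
  "l \<in> set pow_levels \<Longrightarrow> proper pow_seq pow_init l"
  "l \<in> set small_levels \<Longrightarrow> proper small_seq small_init l"
proof -
  obtain m N b W r b' r' V q e where split: "l = (m, N, b, W, r, b', r', V, q, e)"
    using sized.cases[of l] by blast
  show "proper fib_seq fib_init l" if l: "l \<in> set fib_levels"
    using split l levels_sized(1,4) levels_period(1) init_seqs(1,2)
    by (auto simp: list_all_iff intro!: fib_period)
  show "proper pow_seq pow_init l" if l: "l \<in> set pow_levels"
    using split l levels_sized(2,5) levels_period(2) init_seqs(3,4)
    by (auto simp: list_all_iff intro!: pow_seq_period)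
  show "proper small_seq small_init l" if l: "l \<in> set small_levels"
    using split l levels_sized(3,6) init_seqs(5,6)
    by (auto simp: list_all_iff)
qed

lemma matches_covers: "matches moduli p k \<Longrightarrow> p \<in> set ps \<Longrightarrow> covers moduli (Node ps) k"
proof -
  have "covers ms (Node ps) k" if "ms \<noteq> []" "matches ms p k" "p \<in> set ps" for ms
    using that by (cases ms) (auto simp: matches_def intro!: bexI[of _ p])
  then show "matches moduli p k \<Longrightarrow> p \<in> set ps \<Longrightarrow> covers moduli (Node ps) k"
    using moduli_nonempty by blast
qed

lemma tabulates_matches:
  "tabulates f ms N 1 r ps \<Longrightarrow> length ps = r \<Longrightarrow> x < r \<Longrightarrow> [n = x] (mod N) \<Longrightarrow> \<exists>p\<in>set ps. matches ms p (f n)"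
  by (auto simp: tabulates_def position_less intro: bexI[of _ "ps ! x"])

lemma fib_table: "\<exists>p\<in>set fib_table. matches moduli p (int (fib n))"
proof -
  have "tabulates fib_seq moduli 6 1 6 fib_table \<and> length fib_table = 6 * 1"
    unfolding moduli_def fib_table_def using recurrent_seqs(1) levels_linked(1) proper_levels(1)
    unfolding fib_levels_def by (rule table_tabulates)
  then have "\<exists>p\<in>set fib_table. matches moduli p (fib_seq (n + 19))"
    by (intro tabulates_matches[of _ _ 6 6 _ "(n + 19) mod 6"]) (auto simp: cong_def)
  then show ?thesis by (simp add: fib_seq_shift)
qed

lemma pow_table:
  assumes "13 \<le> a"
  shows "covers moduli (Node pow_table) (- (2 ^ a))"
proof -
  have "tabulates pow_seq moduli 1 1 1 pow_table \<and> length pow_table = 1 * 1"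
    unfolding moduli(1) pow_table_def using recurrent_seqs(2) levels_linked(2) proper_levels(2)
    unfolding pow_levels_def by (rule table_tabulates)
  \<comment> \<open>\<open>pow_seq (a - 4)\<close> is \<open>- (2 ^ (a + 153600))\<close>; as 153600
    is a multiple of every period and \<open>a\<close> is at least 13, it is congruent to
    \<open>- (2 ^ a)\<close> modulo every modulus.\<close>
  then have "\<exists>p\<in>set pow_table. matches moduli p (pow_seq (a - 4))"
    by (intro tabulates_matches[of _ _ 1 1 _ 0]) (auto simp: cong_def)
  then have "covers moduli (Node pow_table) (pow_seq (a - 4))"
    by (blast intro: matches_covers)
  then show ?thesis
  proof (rule covers_cong[rotated])
    fix m assume "m \<in> set moduli"
    then obtain l where l: "l \<in> set pow_levels" "m = modulus l" by (auto simp: moduli(1))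
    obtain m' N k where mN: "l = (m', N, k)" by (cases l)
    have "N dvd 153600" using l(1) mN by (auto simp: pow_levels_def)
    then obtain j where j: "153600 = N * j" by blast
    have "mult_mod m (pow2_mod m (num_of_nat 13)) (pow2_mod m (num_of_nat N)) = pow2_mod m (num_of_nat 13)" "0 < N"
      using l mN levels_period(2) levels_sized(5) by (auto simp: list_all_iff)
    from period_cong[of "\<lambda>i. 2 ^ (13 + i)", OF pow2_period[OF this], of "a - 13 + 153600" "a - 13"]
    have "[2 ^ (13 + (a - 13 + 153600)) = (2 ^ (13 + (a - 13)) :: int)] (mod numeral m)"
      unfolding j by (simp add: cong_def)
    moreover have "13 + (a - 13 + 153600) = 153604 + (a - 4)" "13 + (a - 13) = a"
      using assms by auto
    ultimately show "[pow_seq (a - 4) = - (2 ^ a)] (mod numeral m)"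
      by (simp only: pow_seq_def cong_minus_minus_iff)
  qed
qed

lemma small_table:
  assumes "a < 13"
  shows "\<exists>p\<in>set small_table. matches moduli p (- (2 ^ a))"
proof -
  obtain k ls where levels: "small_levels = (4, 0, 1, 1, 13, k) # ls"
    by (auto simp: small_levels_def)
  have "tabulates small_seq moduli 0 1 13 small_table \<and> length small_table = 13 * 1"
    unfolding moduli(2) small_table_def using recurrent_seqs(3) levels_linked(3) proper_levels(3)
    unfolding levels by (rule table_tabulates)
  then have "\<exists>p\<in>set small_table. matches moduli p (small_seq a)"
    using assms by (intro tabulates_matches[of _ _ 0 13 _ a]) auto
  then show ?thesis by (simp add: small_seq_def)
qed

text \<open>The list contains the pair in at least one order, and the order does not affect the sum.
  With at most three further terms, \<open>check_sound\<close> applies.\<close>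

lemma check_pairs_sound:
  assumes "check_pairs moduli ts (pairs xs) us" "x \<in> set xs" "y \<in> set xs" "matches moduli x k" "matches moduli y l"
    and "list_all2 (covers moduli) ts ks" "list_all2 (covers moduli) us ls" "length ts + length us \<le> 3"
  shows "sum_list ks + k + l + sum_list ls \<noteq> 0"
proof -
  have c: "covers moduli (Node [x]) k" "covers moduli (Node [y]) l"
    using matches_covers assms(4,5) by auto
  from pairs[OF assms(2,3)] show ?thesis
  proof
    assume "(x, y) \<in> set (pairs xs)"
    from check_sound[OF check_pairs[OF assms(1) this], of "ks @ [k, l] @ ls"] show ?thesis
      using c assms(6-8) by (auto simp: list_all2_appendI algebra_simps)
  next
    assume "(y, x) \<in> set (pairs xs)"
    from check_sound[OF check_pairs[OF assms(1) this], of "ks @ [l, k] @ ls"] show ?thesis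
      using c assms(6-8) by (auto simp: list_all2_appendI algebra_simps)
  qed
qed

text \<open>Otherwise one, two or three exponents are at least 13, and the corresponding sieve
  excludes the vanishing of the five terms.\<close>

lemma exponent_bound:
  assumes "fib n1 + fib n2 = 2 ^ a1 + 2 ^ a2 + 2 ^ a3" "a3 \<le> a2" "a2 \<le> a1"
  shows "a1 < 13"
proof (rule ccontr)
  assume "\<not> a1 < 13"
  then have P1: "covers moduli (Node pow_table) (- (2 ^ a1))" by (intro pow_table) auto
  have "int (fib n1 + fib n2) = int (2 ^ a1 + 2 ^ a2 + 2 ^ a3)" using assms(1) by (rule arg_cong)
  then have sum: "int (fib n1) + int (fib n2) = 2 ^ a1 + 2 ^ a2 + 2 ^ a3" by simp
  obtain x y where x: "x \<in> set fib_table" "matches moduli x (int (fib n1))"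
    and y: "y \<in> set fib_table" "matches moduli y (int (fib n2))"
    using fib_table by blast
  consider "13 \<le> a3" | "a3 < 13" "13 \<le> a2" | "a2 < 13" by linarith
  then show False
  proof cases
    case 1
    then have "covers moduli (Node pow_table) (- (2 ^ a2))" "covers moduli (Node pow_table) (- (2 ^ a3))"
      using assms(2) by (auto intro: pow_table)
    with P1 check_pairs_sound[OF sieve3[unfolded sieve3.simps] x(1) y(1) x(2) y(2), of "[]" "[- (2 ^ a1), - (2 ^ a2), - (2 ^ a3)]"] sum
    show False by simp
  next
    case 2
    then obtain e where "e \<in> set small_table" "matches moduli e (- (2 ^ a3))"
      using small_table by blast
    then have "covers moduli (Node small_table) (- (2 ^ a3))" by (intro matches_covers)
    moreover have "covers moduli (Node pow_table) (- (2 ^ a2))" using 2 by (intro pow_table)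
    ultimately show False
      using P1 check_pairs_sound[OF sieve2[unfolded sieve2.simps] x(1) y(1) x(2) y(2), of "[- (2 ^ a3)]" "[- (2 ^ a1), - (2 ^ a2)]"] sum
      by simp
  next
    case 3
    then obtain e where e: "e \<in> set small_table" "matches moduli e (- (2 ^ a2))"
      using small_table by blast
    obtain g where g: "g \<in> set small_table" "matches moduli g (- (2 ^ a3))"
      using small_table[of a3] 3 assms(2) by auto
    have c: "covers moduli (Node [e]) (- (2 ^ a2))" "covers moduli (Node [g]) (- (2 ^ a3))"
      using e g by (auto intro: matches_covers)
    from pairs[OF e(1) g(1)] show False
    proof
      assume "(e, g) \<in> set (pairs small_table)"
      from check_pairs_sound[OF check_pairs2[OF sieve1[unfolded sieve1.simps] this] x(1) y(1) x(2) y(2),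
          of "[- (2 ^ a2), - (2 ^ a3)]" "[- (2 ^ a1)]"] c P1 sum
      show False by simp
    next
      assume "(g, e) \<in> set (pairs small_table)"
      from check_pairs_sound[OF check_pairs2[OF sieve1[unfolded sieve1.simps] this] x(1) y(1) x(2) y(2),
          of "[- (2 ^ a3), - (2 ^ a2)]" "[- (2 ^ a1)]"] c P1 sum
      show False by simp
    qed
  qed
qed

section \<open>The remaining solutions\<close>

fun equal_cons :: "bool \<Rightarrow> 'a \<Rightarrow> 'a list \<Rightarrow> 'a list" where
  "equal_cons True x xs = x # xs"
| "equal_cons False x xs = xs"

fun join1 :: "nat \<Rightarrow> 'a \<Rightarrow> (nat \<times> 'b) list \<Rightarrow> ('a \<times> 'b) list" where
  "join1 k x [] = []"
| "join1 k x ((l, y) # ys) = equal_cons (k = l) (x, y) (join1 k x ys)"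

fun join :: "(nat \<times> 'a) list \<Rightarrow> (nat \<times> 'b) list \<Rightarrow> ('a \<times> 'b) list" where
  "join [] ys = []"
| "join ((k, x) # xs) ys = join1 k x ys @ join xs ys"

lemma set_join1: "set (join1 k x ys) = {(x, y) |y. (k, y) \<in> set ys}"
proof (induction k x ys rule: join1.induct)
  case (2 k x l y ys)
  then show ?case by (cases "k = l") auto
qed simp

lemma set_join: "set (join xs ys) = {(x, y). \<exists>k. (k, x) \<in> set xs \<and> (k, y) \<in> set ys}"
  by (induction xs ys rule: join.induct) (auto simp: set_join1)

definition fib_sums :: "(nat \<times> nat \<times> nat) list" where
  "fib_sums = concat (map (\<lambda>n1. map (\<lambda>n2. (fib n1 + fib n2, n1, n2)) [0..<Suc n1]) [0..<22])"

definition pow2_sums :: "(nat \<times> nat \<times> nat \<times> nat) list" where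
  "pow2_sums = concat (map (\<lambda>a1. concat (map (\<lambda>a2. map (\<lambda>a3.
     (2 ^ a1 + 2 ^ a2 + 2 ^ a3, a1, a2, a3)) [0..<Suc a2]) [0..<Suc a1])) [0..<13])"

lemma set_fib_sums: "(k, n1, n2) \<in> set fib_sums \<longleftrightarrow> n1 < 22 \<and> n2 \<le> n1 \<and> k = fib n1 + fib n2"
  by (auto simp: fib_sums_def image_iff simp del: upt_Suc)

lemma set_pow2_sums:
  "(k, a1, a2, a3) \<in> set pow2_sums \<longleftrightarrow> a1 < 13 \<and> a2 \<le> a1 \<and> a3 \<le> a2 \<and> k = 2 ^ a1 + 2 ^ a2 + 2 ^ a3"
  by (auto simp: pow2_sums_def image_iff simp del: upt_Suc)

text \<open>One step of the accumulating recursion, which evaluates Fibonacci numbers in linearly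
  many steps.\<close>

lemma gen_fib_numeral: "gen_fib a b (numeral k) = gen_fib b (a + b) (pred_numeral k)"
proof -
  have "gen_fib a b (Suc n) = gen_fib b (a + b) n" for n by (cases n) simp_all
  then show ?thesis by (simp only: numeral_eq_Suc)
qed

lemma fib_pow2_solutions_join:
  "fib_pow2_solutions = (\<lambda>((a1, a2, a3), (n1, n2)). (n1, n2, a1, a2, a3)) ` set (join pow2_sums fib_sums)"
proof -
  have "a1 < 13 \<and> n1 < 22" if *: "n2 \<le> n1" "a3 \<le> a2" "a2 \<le> a1" "fib n1 + fib n2 = 2 ^ a1 + 2 ^ a2 + 2 ^ a3" for n1 n2 a1 a2 a3
  proof -
    have a1: "a1 < 13" using exponent_bound * by blast
    have "(2 :: nat) ^ k \<le> 2 ^ 12" if "k < 13" for k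
      using that by (intro power_increasing) auto
    \<comment> \<open>The right side is at most \<open>3 * 2 ^ 12 = 12288\<close>, which is less
      than F(22).\<close>
    from this[of a1] this[of a2] this[of a3] a1 * have "fib n1 \<le> 12288" by simp
    moreover have "fib 22 = 17711"
      by (simp add: fib_conv_gen_fib gen_fib_numeral)
    ultimately have "\<not> 22 \<le> n1" using fib_mono[of 22 n1] by linarith
    with a1 show ?thesis by simp
  qed
  then have bound: "(n1, n2, a1, a2, a3) \<in> fib_pow2_solutions \<Longrightarrow> a1 < 13 \<and> n1 < 22" for n1 n2 a1 a2 a3
    by (auto simp: fib_pow2_solutions_def)
  have *: "(n1, n2, a1, a2, a3) \<in> fib_pow2_solutions \<longleftrightarrow> ((a1, a2, a3), n1, n2) \<in> set (join pow2_sums fib_sums)"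
    for n1 n2 a1 a2 a3
    using bound[of n1 n2 a1 a2 a3] unfolding set_join
    by (auto simp: set_fib_sums set_pow2_sums fib_pow2_solutions_def)
  show ?thesis
  proof (rule set_eqI)
    fix p :: "nat \<times> nat \<times> nat \<times> nat \<times> nat"
    obtain n1 n2 a1 a2 a3 where "p = (n1, n2, a1, a2, a3)" by (cases p)
    then show "p \<in> fib_pow2_solutions \<longleftrightarrow>
        p \<in> (\<lambda>((a1, a2, a3), (n1, n2)). (n1, n2, a1, a2, a3)) ` set (join pow2_sums fib_sums)"
      by (simp add: * image_iff Bex_def split_paired_Ex)
  qed
qed

text \<open>Bounds and count are combined so that one evaluation of the join yields both.\<close>

definition admissible :: "((nat \<times> nat \<times> nat) \<times> (nat \<times> nat)) list \<Rightarrow> bool" where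
  "admissible xs \<longleftrightarrow> length xs = 78 \<and> distinct xs \<and> list_all (\<lambda>((a1, a2, a3), (n1, n2)). n1 \<le> 18 \<and> a1 \<le> 11) xs"

lemmas upt_eval = upt_rec[of 0 "numeral k"] upt_rec[of "Suc 0" "numeral k"] for k

lemma admissible_join: "admissible (join pow2_sums fib_sums)"
  \<comment> \<open>First both lists of sums are expanded, then joined on equal sums, and then the
    resulting entries are inspected.\<close>
  by (simp add: fib_sums_def pow2_sums_def fib_conv_gen_fib gen_fib_numeral upt_eval numeral_2_eq_2[symmetric]
        del: gen_fib.simps(3) join.simps,
      simp only: join.simps join1.simps equal_cons.simps append.simps rel_simps num.inject num.distinct simp_thms,
      simp add: admissible_def)

theorem theorem1p1:
  shows "(\<forall>n1 n2 a1 a2 a3. (n1, n2, a1, a2, a3) \<in> fib_pow2_solutions \<longrightarrow> n1 \<le> 18 \<and> a1 \<le> 11)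
         \<and> card fib_pow2_solutions = 78"
proof
  show "\<forall>n1 n2 a1 a2 a3. (n1, n2, a1, a2, a3) \<in> fib_pow2_solutions \<longrightarrow> n1 \<le> 18 \<and> a1 \<le> 11"
    using admissible_join unfolding admissible_def fib_pow2_solutions_join list_all_iff by auto
  \<comment> \<open>Reordering the components is injective, so the solutions are counted by the
    length of the distinct list.\<close>
  have "inj (\<lambda>((a1, a2, a3), (n1, n2)). (n1 :: nat, n2 :: nat, a1 :: nat, a2 :: nat, a3 :: nat))"
    by (auto simp: inj_def)
  then show "card fib_pow2_solutions = 78"
    using admissible_join distinct_card[of "join pow2_sums fib_sums"]
    unfolding admissible_def fib_pow2_solutions_join by (simp add: card_image inj_on_subset)
qed

end
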